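(* Let $A, B \in \mathbb{F}^{n\times n}$, and suppose $A$ satisfies property $\mathcal{R}$ and has no cut. Then $\det(A[S]) = \det(B[S])$ for all nonempty $S\subseteq[n]$ if and only if $\det(A[S]) = \det(B[S])$ for all nonempty $S \subseteq [n]$ with $|S| \le 4$.
   Context: $M[S,T]$ is the submatrix with rows indexed by $S$ and columns by $T$, $M[S]=M[S,S]$, $\overline{S}=[n]\setminus S$. For $n\ge 4$, $X\subseteq[n]$ is a cut of $A$ if $2\le|X|\le n-2$ and both $A[X,\overline{X}]$ and $A[\overline{X}, X]$ have rank at most one. $A$ satisfies property $\mathcal{R}$ if (i) all off-diagonal entries are nonzero, and (ii) whenever $i,j,k,\ell\in[n]$ are distinct with $\mathrm{rank}(A[\{i,j\},\{k,\ell\}])=1$, there exists $S\subseteq[n]$ with $i,j\in S$, $k,\ell\in\overline{S}$ and $\mathrm{rank}(A[S,\overline{S}])=1$. *)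

theory Defs
  imports
    "Jordan_Normal_Form.Determinant"
    "Jordan_Normal_Form.DL_Rank"
    "Jordan_Normal_Form.DL_Submatrix"
begin

text \<open>
  The index set \<open>[n]\<close> is \<open>{..<n}\<close>, following the 0-based indexing of matrices;
  \<open>A[S,T]\<close> is \<open>submatrix A S T\<close>. The first argument of \<^const>\<open>vec_space.rank\<close> is the
  dimension of the space containing the columns, that is, the number of rows.
\<close>

definition mat_rank :: "'a::field mat \<Rightarrow> nat" where
  "mat_rank M = vec_space.rank (dim_row M) M"

definition is_cut :: "nat \<Rightarrow> 'a::field mat \<Rightarrow> nat set \<Rightarrow> bool" where
  "is_cut n A X \<longleftrightarrow>
     4 \<le> n \<and> X \<subseteq> {..<n} \<and> 2 \<le> card X \<and> card X \<le> n - 2 \<and>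
     mat_rank (submatrix A X ({..<n} - X)) \<le> 1 \<and>
     mat_rank (submatrix A ({..<n} - X) X) \<le> 1"

definition property_R :: "nat \<Rightarrow> 'a::field mat \<Rightarrow> bool" where
  "property_R n A \<longleftrightarrow>
     (\<forall>i<n. \<forall>j<n. i \<noteq> j \<longrightarrow> A $$ (i, j) \<noteq> 0) \<and>
     (\<forall>i<n. \<forall>j<n. \<forall>k<n. \<forall>l<n.
        distinct [i, j, k, l] \<and> mat_rank (submatrix A {i, j} {k, l}) = 1 \<longrightarrow>
        (\<exists>S \<subseteq> {..<n}. i \<in> S \<and> j \<in> S \<and> k \<in> {..<n} - S \<and> l \<in> {..<n} - S \<and>
           mat_rank (submatrix A S ({..<n} - S)) = 1))"

end

theory Submission
  imports Defs "Jordan_Normal_Form.DL_Rank_Submatrix"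
begin

text \<open>
  Principal minors of order at most three say that every 3-cycle product of \<open>B\<close> agrees with that
  of \<open>A\<close> or of its transpose: each triple is \<^emph>\<open>same\<close> or \<^emph>\<open>turned\<close> (or both, if it is balanced).
  If all triples are same, \<open>B\<close> is diagonally similar to \<open>A\<close>; if all are turned, to the transpose
  of \<open>A\<close>. The minors of order four force a 4-set with triples of both strict kinds to be
  \<^emph>\<open>mixed\<close>: it splits into two pairs, both off-diagonal 2 by 2 blocks are singular, and the two
  triples containing one of the pairs are of one kind, the two others of the other kind.

  Property R enters only as a five-point condition: if rows \<open>i\<close>, \<open>j\<close> are parallel on columns
  \<open>k\<close>, \<open>l\<close>, then any fifth index can be added to the rows or to the columns. Hence, for a set
  \<open>X\<close>, the class \<open>K\<close> of all columns on which the rows in \<open>X\<close> are parallel to a given column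
  has \<open>A[K\<^sup>c, K]\<close> of rank one; if the class defined through \<open>A\<close> and the one defined through the
  transpose coincide, \<open>K\<close> is a cut.

  Suppose that there are triples of both strict kinds and no cut. A mixed 4-set exists, and
  enlarging its bipartition as far as possible produces an uncut 4-set with an unbalanced triple,
  which therefore is not mixed. Let \<open>Q\<close> be a maximal uncut set with an unbalanced triple
  on which all triples are, say, same. If \<open>Q \<union> {m}\<close> is uncut it is again of one kind, since in the
  link of \<open>m\<close> a connected component of strictly same pairs would yield a cut. So every \<open>m\<close> outside
  \<open>Q\<close> is a twin of a unique \<open>q\<close> in \<open>Q\<close>, meaning that \<open>{m, q}\<close> is a cut of \<open>Q \<union> {m}\<close>. As the whole
  index set has no cut, there are twins \<open>m\<close>, \<open>v\<close> of different elements of \<open>Q\<close> with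
  \<open>Q \<union> {m, v}\<close> uncut, and this set is again of one kind, contradicting maximality.
\<close>

section \<open>Matrices in which rank-one blocks extend\<close>

definition flip_args :: "('v \<Rightarrow> 'v \<Rightarrow> 'a) \<Rightarrow> 'v \<Rightarrow> 'v \<Rightarrow> 'a" where
  "flip_args f x y = f y x"

definition cyc :: "('v \<Rightarrow> 'v \<Rightarrow> 'a::field) \<Rightarrow> 'v \<Rightarrow> 'v \<Rightarrow> 'v \<Rightarrow> 'a" where
  "cyc f i j k = f i j * f j k * f k i"

text \<open>Rows \<open>i\<close>, \<open>j\<close> are parallel on columns \<open>k\<close>, \<open>l\<close>, that is, \<open>f[{i, j}, {k, l}]\<close> is singular.\<close>

definition par :: "('v \<Rightarrow> 'v \<Rightarrow> 'a::field) \<Rightarrow> 'v \<Rightarrow> 'v \<Rightarrow> 'v \<Rightarrow> 'v \<Rightarrow> bool" where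
  "par f i j k l \<longleftrightarrow> f i k * f j l = f i l * f j k"

definition cut4 :: "('v \<Rightarrow> 'v \<Rightarrow> 'a::field) \<Rightarrow> 'v \<Rightarrow> 'v \<Rightarrow> 'v \<Rightarrow> 'v \<Rightarrow> bool" where
  "cut4 f i j k l \<longleftrightarrow> par f i j k l \<and> par f k l i j"

text \<open>With \<open>r x y = f x y / f y x\<close> this is \<open>r i j * r j k * r k i\<close>,
  a multiplicative coboundary that diagonal similarity leaves unchanged.\<close>

definition tratio :: "('v \<Rightarrow> 'v \<Rightarrow> 'a::field) \<Rightarrow> 'v \<Rightarrow> 'v \<Rightarrow> 'v \<Rightarrow> 'a" where
  "tratio f i j k = cyc f i j k / cyc f i k j"

definition balanced :: "('v \<Rightarrow> 'v \<Rightarrow> 'a::field) \<Rightarrow> 'v \<Rightarrow> 'v \<Rightarrow> 'v \<Rightarrow> bool" where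
  "balanced f i j k \<longleftrightarrow> cyc f i j k = cyc f i k j"

text \<open>Rank at most one is expressed by vanishing 2 by 2 minors and size at least two by pairs
  of distinct elements, so the notion relativizes to every subset \<open>Z\<close>.\<close>

definition cutset :: "('v \<Rightarrow> 'v \<Rightarrow> 'a::field) \<Rightarrow> 'v set \<Rightarrow> 'v set \<Rightarrow> bool" where
  "cutset f Z X \<longleftrightarrow> X \<subseteq> Z \<and> (\<exists>x\<in>X. \<exists>x'\<in>X. x \<noteq> x') \<and> (\<exists>y\<in>Z - X. \<exists>y'\<in>Z - X. y \<noteq> y') \<and>
     (\<forall>x\<in>X. \<forall>x'\<in>X. \<forall>y\<in>Z - X. \<forall>y'\<in>Z - X. cut4 f x x' y y')"

lemma par_refl [simp]: "par f i i k l" "par f i j k k"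
  by (simp_all add: par_def)

lemma par_commute: "par f i j k l = par f j i k l" "par f i j k l = par f i j l k"
  unfolding par_def by (metis mult.commute)+

lemma cut4_refl [simp]: "cut4 f i i k l" "cut4 f i j k k"
  by (simp_all add: cut4_def)

lemma cut4_commute: "cut4 f i j k l = cut4 f j i k l" "cut4 f i j k l = cut4 f i j l k"
  by (simp_all add: cut4_def par_commute)

lemma cut4_flip: "cut4 f i j k l = cut4 f k l i j"
  by (auto simp: cut4_def)

lemma balanced_commute: "balanced f i j k = balanced f j i k" "balanced f i j k = balanced f i k j"
proof -
  have "cyc f j i k = cyc f i k j" "cyc f j k i = cyc f i j k" by (simp_all add: cyc_def mult_ac)
  then show "balanced f i j k = balanced f j i k" "balanced f i j k = balanced f i k j"
    unfolding balanced_def by metis+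
qed

lemma tratio_rotate: "tratio f i j k = tratio f j k i"
  by (simp add: tratio_def cyc_def mult_ac)

lemma cutset_compl:
  assumes "cutset f Z X"
  shows "cutset f Z (Z - X)"
proof -
  have "Z - (Z - X) = X" using assms by (auto simp: cutset_def)
  then show ?thesis using assms unfolding cutset_def by (metis Diff_subset cut4_flip)
qed

lemma par_transpose: "par (flip_args f) i j k l = par f k l i j"
  by (simp add: par_def flip_args_def mult_ac)

lemma cut4_transpose: "cut4 (flip_args f) = cut4 f"
  by (auto simp: cut4_def par_transpose fun_eq_iff)

lemma cyc_transpose: "cyc (flip_args f) i j k = cyc f i k j"
  by (simp add: cyc_def flip_args_def mult_ac)

lemma balanced_transpose: "balanced (flip_args f) = balanced f"
  unfolding balanced_def cyc_transpose fun_eq_iff by metis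

lemma cutset_transpose: "cutset (flip_args f) = cutset f"
  by (simp add: cutset_def cut4_transpose fun_eq_iff)

text \<open>\<open>extend\<close> is property R seen on five indices: \<open>m\<close> lies in the
  set \<open>S\<close> and joins the rows, or in its complement and joins the columns.\<close>

locale rank_one_extending =
  fixes a :: "'v \<Rightarrow> 'v \<Rightarrow> 'a::field" and V :: "'v set"
  assumes finV: "finite V"
    and nz: "\<lbrakk>x \<in> V; y \<in> V; x \<noteq> y\<rbrakk> \<Longrightarrow> a x y \<noteq> 0"
    and extend: "\<lbrakk>distinct [i, j, k, l, m]; {i, j, k, l, m} \<subseteq> V; par a i j k l\<rbrakk>
      \<Longrightarrow> par a i m k l \<or> par a i j k m"
begin

lemma transpose: "rank_one_extending (flip_args a) V"
proof
  show "finite V" by (rule finV)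
next
  fix i j k l m
  assume "distinct [i, j, k, l, m]" "{i, j, k, l, m} \<subseteq> V" "par (flip_args a) i j k l"
  then show "par (flip_args a) i m k l \<or> par (flip_args a) i j k m"
    using extend[of k l i j m] by (auto simp: par_transpose)
qed (use nz in \<open>auto simp: flip_args_def\<close>)

text \<open>Multiply the two relations and cancel \<open>a j k * a j l\<close>. The side conditions
  keep these two entries off the diagonal, hence nonzero; \<open>i\<close> and \<open>h\<close> are
  arbitrary.\<close>

lemma par_trans_row:
  assumes "par a i j k l" "par a j h k l" "j \<noteq> k" "j \<noteq> l" "{j, k, l} \<subseteq> V"
  shows "par a i h k l"
proof -
  have z: "a j k \<noteq> 0" "a j l \<noteq> 0" using assms nz by auto
  have "a i k * a h l * (a j k * a j l) = (a i k * a j l) * (a j k * a h l)" by (simp add: mult_ac)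
  also have "\<dots> = (a i l * a j k) * (a j l * a h k)" using assms by (simp add: par_def)
  also have "\<dots> = a i l * a h k * (a j k * a j l)" by (simp add: mult_ac)
  finally show ?thesis using z by (simp add: par_def)
qed

lemma par_trans_col:
  assumes "par a i j k l" "par a i j l h" "i \<noteq> l" "j \<noteq> l" "{i, j, l} \<subseteq> V"
  shows "par a i j k h"
proof -
  have "par (flip_args a) k h i j"
    by (rule rank_one_extending.par_trans_row[OF transpose, of k l])
      (use assms in \<open>auto simp: par_transpose\<close>)
  then show ?thesis by (simp add: par_transpose)
qed

lemma cut4_trans:
  assumes "cut4 a i j k l" "cut4 a j h k l" "j \<noteq> k" "j \<noteq> l" "{j, k, l} \<subseteq> V"
  shows "cut4 a i h k l"
  using assms par_trans_row[of i j k l h] par_trans_col[of k l i j h] by (auto simp: cut4_def)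

lemma cyc_nz: "\<lbrakk>distinct [i, j, k]; {i, j, k} \<subseteq> V\<rbrakk> \<Longrightarrow> cyc a i j k \<noteq> 0"
  by (auto simp: cyc_def nz)

lemma balanced_iff:
  "\<lbrakk>distinct [i, j, k]; {i, j, k} \<subseteq> V\<rbrakk> \<Longrightarrow> balanced a i j k \<longleftrightarrow> tratio a i j k = 1"
  using cyc_nz[of i k j] by (auto simp: balanced_def tratio_def)

lemma tratio_nz: "\<lbrakk>distinct [i, j, k]; {i, j, k} \<subseteq> V\<rbrakk> \<Longrightarrow> tratio a i j k \<noteq> 0"
  using cyc_nz[of i j k] cyc_nz[of i k j] by (auto simp: tratio_def)

text \<open>Both sides are the ratio of the 4-cycle through \<open>i\<close>, \<open>j\<close>,
  \<open>k\<close>, \<open>l\<close> to its reversal; the factors of the chords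
  \<open>{i, k}\<close> and \<open>{j, l}\<close> cancel.\<close>

lemma tratio_cocycle:
  assumes "distinct [i, j, k, l]" "{i, j, k, l} \<subseteq> V"
  shows "tratio a i j k * tratio a i k l = tratio a i j l * tratio a j k l"
proof -
  have "a i j \<noteq> 0" "a i k \<noteq> 0" "a i l \<noteq> 0" "a j i \<noteq> 0" "a j k \<noteq> 0" "a j l \<noteq> 0"
    "a k i \<noteq> 0" "a k j \<noteq> 0" "a k l \<noteq> 0" "a l i \<noteq> 0" "a l j \<noteq> 0" "a l k \<noteq> 0"
    using assms nz by auto
  then show ?thesis
    by (simp add: tratio_def cyc_def times_divide_times_eq frac_eq_eq)
qed

text \<open>The quotient of the two ratios is the product of suitably oriented cross ratios of the
  blocks \<open>[{i, j}, {k, m}]\<close> and \<open>[{k, m}, {i, j}]\<close>. When the first is 1,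
  the ratios agree exactly if the second is 1.\<close>

lemma par_iff_tratio:
  assumes "distinct [i, j, k, m]" "{i, j, k, m} \<subseteq> V" "par a i j k m"
  shows "par a k m i j \<longleftrightarrow> tratio a i j k = tratio a i j m"
proof -
  have z: "a i j \<noteq> 0" "a i k \<noteq> 0" "a i m \<noteq> 0" "a j i \<noteq> 0" "a j k \<noteq> 0" "a j m \<noteq> 0"
    "a k i \<noteq> 0" "a k j \<noteq> 0" "a k m \<noteq> 0" "a m i \<noteq> 0" "a m j \<noteq> 0" "a m k \<noteq> 0"
    using assms nz by auto
  have p: "a i k * a j m = a i m * a j k" using assms(3) by (simp add: par_def)
  have "tratio a i j k = tratio a i j m \<longleftrightarrow>
      (a i m * a j k) * (a k i * a m j) = (a i k * a j m) * (a m i * a k j)"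
    using z by (simp add: tratio_def cyc_def frac_eq_eq mult_ac)
  also have "\<dots> \<longleftrightarrow> a k i * a m j = a m i * a k j"
    unfolding p using z by simp
  finally show ?thesis by (auto simp: par_def mult_ac)
qed

lemma cut4_tratio:
  "\<lbrakk>distinct [i, j, k, m]; {i, j, k, m} \<subseteq> V; cut4 a i j k m\<rbrakk> \<Longrightarrow> tratio a i j k = tratio a i j m"
  using par_iff_tratio by (auto simp: cut4_def)

lemma cut4_balanced:
  "\<lbrakk>distinct [i, j, k, m]; {i, j, k, m} \<subseteq> V; cut4 a i j k m\<rbrakk>
    \<Longrightarrow> balanced a i j k \<longleftrightarrow> balanced a i j m"
  using cut4_tratio[of i j k m] by (simp add: balanced_iff)

lemma balanced_two:
  assumes "distinct [i, j, k, m]" "{i, j, k, m} \<subseteq> V" "balanced a i k m" "balanced a j k m"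
  shows "tratio a i j k = tratio a i j m"
  using tratio_cocycle[of i j k m] assms by (simp add: balanced_iff)

text \<open>By the cocycle identity the ratios over the pair \<open>{k, m}\<close> agree as well, so
  \<open>par_iff_tratio\<close> applies from both sides. Combined with \<open>balanced_two\<close>,
  this makes balanced triples force the matrix and its transpose to agree on parallelism.\<close>

lemma par_flip_iff:
  assumes d: "distinct [i, j, k, m]" "{i, j, k, m} \<subseteq> V" and t: "tratio a i j k = tratio a i j m"
  shows "par a i j k m \<longleftrightarrow> par a k m i j"
proof -
  have "tratio a i k m = tratio a j k m"
    using tratio_cocycle[OF d] tratio_nz[of i j m] d t by simp
  then have "tratio a k m i = tratio a k m j" by (simp add: tratio_rotate[of a i k m] tratio_rotate[of a j k m])
  then show ?thesis using par_iff_tratio[of i j k m] par_iff_tratio[of k m i j] t d by auto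
qed

text \<open>
  A row outside \<open>K\<close> and \<open>X\<close> is not parallel to \<open>X\<close> as a column, so the five-point condition makes it
  parallel to \<open>X\<close> as a row on \<open>K\<close>.
\<close>

lemma par_columns:
  assumes XZ: "X \<subseteq> Z" "Z \<subseteq> V" and y0: "y0 \<in> Z - X"
    and xs: "x0 \<in> X"
    and K: "K = {v \<in> Z - X. \<forall>x\<in>X. \<forall>x'\<in>X. par a x x' y0 v}"
    and p: "p \<in> Z - K" "p' \<in> Z - K" and q: "q \<in> K" "q' \<in> K"
  shows "par a p p' q q'"
proof (cases "q = q'")
  case False
  have qV: "q \<in> V" "q' \<in> V" "q \<notin> X" "q' \<notin> X" using q K XZ by auto
  have X2: "par a x x' q q'" if "x \<in> X" "x' \<in> X" for x x'
    using par_trans_col[of x x' q y0 q'] that q K XZ y0 by (auto simp: par_commute)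
  have "par a r x0 q q'" if r: "r \<in> Z - K" for r
  proof (cases "r \<in> X")
    case True then show ?thesis using X2 xs by simp
  next
    case F: False
    then obtain x x' where x: "x \<in> X" "x' \<in> X" "\<not> par a x x' y0 r" using r K by auto
    have ne: "r \<noteq> q" "r \<noteq> q'" "r \<in> V" using r q XZ by auto
    have xx: "x \<noteq> x'" using x by auto
    have "\<not> par a x x' q r"
      using x par_trans_col[of x x' y0 q r] q K XZ y0 by auto
    moreover have "distinct [x, x', q, q', r]" using x xx False F qV ne by auto
    moreover have "{x, x', q, q', r} \<subseteq> V" using x qV ne XZ by auto
    ultimately have "par a x r q q'" using extend[of x x' q q' r] X2[of x x'] x by auto
    then show ?thesis
      using par_trans_row[of r x q q' x0] X2[of x x0] x xs qV XZ by (auto simp: par_commute)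
  qed
  from this[OF p(1)] this[OF p(2)] show ?thesis
    using par_trans_row[of p x0 q q' p'] xs qV XZ by (auto simp: par_commute)
qed simp

text \<open>By \<open>eq\<close> the column class \<open>K\<close> of \<open>y0\<close> is the same
  for the matrix and its transpose, so \<open>par_columns\<close> makes both off-diagonal blocks of
  \<open>K\<close> rank one. \<open>y0\<close>, \<open>y1\<close> and \<open>x0\<close>,
  \<open>x1\<close> are the distinct pairs on the two sides.\<close>

lemma cutset_columns:
  assumes XZ: "X \<subseteq> Z" "Z \<subseteq> V" and y: "y0 \<in> Z - X" "y1 \<in> Z - X" "y0 \<noteq> y1"
    and xs: "x0 \<in> X" "x1 \<in> X" "x0 \<noteq> x1"
    and y1: "\<And>x x'. \<lbrakk>x \<in> X; x' \<in> X\<rbrakk> \<Longrightarrow> cut4 a x x' y0 y1"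
    and eq: "\<And>v. \<lbrakk>v \<in> Z - X\<rbrakk> \<Longrightarrow>
      (\<forall>x\<in>X. \<forall>x'\<in>X. par a x x' y0 v) \<longleftrightarrow> (\<forall>x\<in>X. \<forall>x'\<in>X. par a y0 v x x')"
  shows "\<exists>K. cutset a Z K \<and> y0 \<in> K \<and> y1 \<in> K \<and> K \<inter> X = {}"
proof -
  define K where "K = {v \<in> Z - X. \<forall>x\<in>X. \<forall>x'\<in>X. par a x x' y0 v}"
  have K': "K = {v \<in> Z - X. \<forall>x\<in>X. \<forall>x'\<in>X. par (flip_args a) x x' y0 v}"
    unfolding K_def using eq by (auto simp: par_transpose)
  have yK: "y0 \<in> K" "y1 \<in> K" using y y1 by (auto simp: K_def cut4_def)
  have KZ: "K \<subseteq> Z" "K \<inter> X = {}" by (auto simp: K_def)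
  have c: "cut4 a q q' p p'" if "q \<in> K" "q' \<in> K" "p \<in> Z - K" "p' \<in> Z - K" for p p' q q'
    using par_columns[OF XZ y(1) xs(1) K_def that(3,4,1,2)]
      rank_one_extending.par_columns[OF transpose XZ y(1) xs(1) K' that(3,4,1,2)]
    by (simp add: cut4_def par_transpose)
  have "x0 \<in> Z - K" "x1 \<in> Z - K" using xs KZ XZ by auto
  then have "cutset a Z K" unfolding cutset_def using yK y(3) xs(3) KZ(1) c by blast
  then show ?thesis using yK KZ by blast
qed

end

section \<open>Cuts of 4-sets and linked bipartitions\<close>

lemma cutset_four:
  assumes "cutset f {i, j, k, m} X" "distinct [i, j, k, m]"
  shows "cut4 f i j k m \<or> cut4 f i k j m \<or> cut4 f i m j k"
proof -
  obtain x x' y y' where "x \<in> X" "x' \<in> X" "x \<noteq> x'" "y \<in> {i, j, k, m} - X" "y' \<in> {i, j, k, m} - X"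
    "y \<noteq> y'" "cut4 f x x' y y'" "X \<subseteq> {i, j, k, m}"
    using assms(1) unfolding cutset_def by meson
  then have "x \<in> {i, j, k, m}" "x' \<in> {i, j, k, m} - {x}" "y \<in> {i, j, k, m} - {x, x'}"
    "y' \<in> {i, j, k, m} - {x, x', y}" "cut4 f x x' y y'" by auto
  then show ?thesis using assms(2)
    by (elim insertE DiffE emptyE; simp add: cut4_commute cut4_flip; blast?)
qed

context rank_one_extending
begin

text \<open>After multiplication by \<open>a k m * a l m\<close>, the four relations turn one
  orientation of the 3-cycle into the other. The situation arises when \<open>{i, j, k, m}\<close>
  and \<open>{i, j, l, m}\<close> are cut by different pairings.\<close>

lemma balanced_of_crossing:
  assumes d: "distinct [i, j, k, l, m]" "{i, j, k, l, m} \<subseteq> V"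
    and p: "par a i j k m" "par a k l i m" "par a i k j m" "par a j l i m"
  shows "balanced a i j k"
proof -
  have z: "a k m \<noteq> 0" "a l m \<noteq> 0" using d nz by auto
  have e: "a i k * a j m = a i m * a j k" "a k i * a l m = a k m * a l i"
    "a i j * a k m = a i m * a k j" "a j i * a l m = a j m * a l i"
    using p by (simp_all add: par_def)
  have "cyc a i j k * (a k m * a l m) = (a i j * a k m) * a j k * (a k i * a l m)"
    by (simp add: cyc_def mult_ac)
  also have "\<dots> = (a i m * a j k) * a k j * (a k m * a l i)" unfolding e by (simp add: mult_ac)
  also have "\<dots> = a i k * a k j * (a j m * a l i) * a k m" unfolding e(1)[symmetric] by (simp add: mult_ac)
  also have "\<dots> = cyc a i k j * (a k m * a l m)" unfolding e(4)[symmetric] by (simp add: cyc_def mult_ac)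
  finally show ?thesis using z by (simp add: balanced_def)
qed

text \<open>Suppose that both 4-sets are cut. Rows \<open>k\<close>, \<open>m\<close> and rows
  \<open>l\<close>, \<open>m\<close> are not parallel on \<open>i\<close>, \<open>j\<close>, so no
  cut keeps \<open>i\<close> and \<open>j\<close> together. Matching pairings then give
  \<open>par a i m k l\<close> by transitivity, and crossing pairings make \<open>{i, j, k}\<close>
  balanced.\<close>

lemma uncut_four_of_bad:
  assumes d: "distinct [i, j, k, l, m]" "{i, j, k, l, m} \<subseteq> V"
    and p: "par a i j k l" "par a i j k m" "par a k l i j" "par a k l i m"
    and n: "\<not> par a i m k l" "\<not> par a k m i j" "\<not> balanced a i j k"
  shows "\<not> (\<exists>X. cutset a {i, j, k, m} X) \<or> \<not> (\<exists>X. cutset a {i, j, l, m} X)"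
proof (rule ccontr)
  assume "\<not> ?thesis"
  then obtain X X' where X: "cutset a {i, j, k, m} X" "cutset a {i, j, l, m} X'" by blast
  have "cut4 a i j k m \<or> cut4 a i k j m \<or> cut4 a i m j k"
    by (rule cutset_four[OF X(1)]) (use d in auto)
  then have 1: "cut4 a i k j m \<or> cut4 a i m j k" using n by (auto simp: cut4_def)
  have "\<not> par a l m i j"
    using n(2) p(3) par_trans_row[of k l i j m] d by auto
  moreover have "cut4 a i j l m \<or> cut4 a i l j m \<or> cut4 a i m j l"
    by (rule cutset_four[OF X(2)]) (use d in auto)
  ultimately have 2: "cut4 a i l j m \<or> cut4 a i m j l" by (auto simp: cut4_def)
  have klj: "par a k l j m" using p(3,4) par_trans_col[of k l j i m] d by (auto simp: par_commute)
  from 1 2 consider "cut4 a i k j m" "cut4 a i l j m" | "cut4 a i m j k" "cut4 a i m j l"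
    | "cut4 a i k j m" "cut4 a i m j l" | "cut4 a i m j k" "cut4 a i l j m" by blast
  then show False
  proof cases
    case 1
    then have "par a j m k i" "par a j m i l" by (auto simp: cut4_def par_commute)
    then have "par a j m k l" using par_trans_col[of j m k i l] d by auto
    then show False using n(1) p(1) par_trans_row[of i j k l m] d by auto
  next
    case 2
    then have "par a i m k j" "par a i m j l" by (auto simp: cut4_def par_commute)
    then show False using n(1) par_trans_col[of i m k j l] d by auto
  next
    case 3
    then have "par a i k j m" "par a j l i m" by (auto simp: cut4_def)
    then show False using balanced_of_crossing[of i j k l m] d p n by auto
  next
    case 4
    then have "par a i l j m" "par a j k i m" "par a j i k m" using p by (auto simp: cut4_def par_commute)
    then have "balanced a j i k" using balanced_of_crossing[of j i k l m] d klj by auto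
    then show False using n(3) by (simp add: balanced_commute)
  qed
qed

text \<open>\<open>X\<close> is connected by the edges \<open>{x, x'}\<close> for which some triple \<open>{x, x', y}\<close> is unbalanced.\<close>

definition linked :: "'v set \<Rightarrow> 'v set \<Rightarrow> bool" where
  "linked X Y \<longleftrightarrow> (\<forall>P\<subseteq>X. P \<noteq> {} \<and> P \<noteq> X \<longrightarrow> (\<exists>x\<in>P. \<exists>x'\<in>X - P. \<exists>y\<in>Y. \<not> balanced a x x' y))"

definition linked_cut :: "'v set \<Rightarrow> 'v set \<Rightarrow> bool" where
  "linked_cut X Y \<longleftrightarrow> X \<subseteq> V \<and> Y \<subseteq> V \<and> X \<inter> Y = {} \<and> cutset a (X \<union> Y) X \<and> linked X Y"

lemma linked_cutD:
  assumes "linked_cut X Y"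
  shows "X \<subseteq> V" "Y \<subseteq> V" "X \<inter> Y = {}" "\<exists>x\<in>X. \<exists>x'\<in>X. x \<noteq> x'" "\<exists>y\<in>Y. \<exists>y'\<in>Y. y \<noteq> y'"
    "\<And>x x' y y'. \<lbrakk>x \<in> X; x' \<in> X; y \<in> Y; y' \<in> Y\<rbrakk> \<Longrightarrow> cut4 a x x' y y'" "linked X Y"
proof -
  have "X \<union> Y - X = Y" using assms by (auto simp: linked_cut_def)
  then show "X \<subseteq> V" "Y \<subseteq> V" "X \<inter> Y = {}" "\<exists>x\<in>X. \<exists>x'\<in>X. x \<noteq> x'" "\<exists>y\<in>Y. \<exists>y'\<in>Y. y \<noteq> y'"
    "\<And>x x' y y'. \<lbrakk>x \<in> X; x' \<in> X; y \<in> Y; y' \<in> Y\<rbrakk> \<Longrightarrow> cut4 a x x' y y'" "linked X Y"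
    using assms by (auto simp: linked_cut_def cutset_def)
qed

lemma linked_cutI:
  assumes "X \<subseteq> V" "Y \<subseteq> V" "X \<inter> Y = {}" "\<exists>x\<in>X. \<exists>x'\<in>X. x \<noteq> x'" "\<exists>y\<in>Y. \<exists>y'\<in>Y. y \<noteq> y'"
    "\<And>x x' y y'. \<lbrakk>x \<in> X; x' \<in> X; y \<in> Y; y' \<in> Y\<rbrakk> \<Longrightarrow> cut4 a x x' y y'" "linked X Y"
  shows "linked_cut X Y"
proof -
  have "X \<union> Y - X = Y" using assms by auto
  then show ?thesis using assms unfolding linked_cut_def cutset_def by simp
qed

lemma linked_cut_join_right:
  assumes lc: "linked_cut X Y" and m: "m \<in> V - X - Y"
    and out: "\<And>x x' y. \<lbrakk>x \<in> X; x' \<in> X; y \<in> Y\<rbrakk> \<Longrightarrow> cut4 a x x' y m"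
  shows "linked_cut X (insert m Y)"
proof (rule linked_cutI)
  fix x x' y y' assume "x \<in> X" "x' \<in> X" "y \<in> insert m Y" "y' \<in> insert m Y"
  then show "cut4 a x x' y y'"
    using linked_cutD(6)[OF lc] out by (auto simp: cut4_commute(2)[of _ _ _ m])
next
  show "linked X (insert m Y)" using linked_cutD(7)[OF lc] unfolding linked_def by blast
qed (use linked_cutD[OF lc] m in blast)+

text \<open>The unbalanced triple \<open>{e, m, z}\<close> supplies the edge that attaches
  \<open>m\<close> to \<open>X\<close> and so keeps the left side connected.\<close>

lemma linked_cut_join_left:
  assumes lc: "linked_cut X Y" and m: "m \<in> V - X - Y"
    and out: "\<And>x y y'. \<lbrakk>x \<in> X; y \<in> Y; y' \<in> Y\<rbrakk> \<Longrightarrow> cut4 a x m y y'"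
    and e: "e \<in> X" "z \<in> Y" "\<not> balanced a e m z"
  shows "linked_cut (insert m X) Y"
proof (rule linked_cutI)
  fix x x' y y' assume "x \<in> insert m X" "x' \<in> insert m X" "y \<in> Y" "y' \<in> Y"
  then show "cut4 a x x' y y'"
    using linked_cutD(6)[OF lc] out by (auto simp: cut4_commute(1)[of _ m])
next
  show "linked (insert m X) Y"
    unfolding linked_def
  proof (intro allI impI)
    fix P assume P: "P \<subseteq> insert m X" "P \<noteq> {} \<and> P \<noteq> insert m X"
    show "\<exists>x\<in>P. \<exists>x'\<in>insert m X - P. \<exists>y\<in>Y. \<not> balanced a x x' y"
    proof (cases "P \<inter> X = {} \<or> P \<inter> X = X")
      case True
      then consider "P = {m}" | "P = X" using P by blast
      then show ?thesis
      proof cases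
        case 1 then show ?thesis using e m by (force simp: balanced_commute)
      next
        case 2 then show ?thesis using e m by force
      qed
    next
      case False
      then show ?thesis using linked_cutD(7)[OF lc] unfolding linked_def
        by (elim allE[of _ "P \<inter> X"]) blast
    qed
  qed
qed (use linked_cutD[OF lc] m in blast)+

end

section \<open>Finding an uncut 4-set with an unbalanced triple\<close>

definition unbalanced_in :: "('v \<Rightarrow> 'v \<Rightarrow> 'a::field) \<Rightarrow> 'v set \<Rightarrow> bool" where
  "unbalanced_in f Q \<longleftrightarrow> (\<exists>x y z. {x, y, z} \<subseteq> Q \<and> distinct [x, y, z] \<and> \<not> balanced f x y z)"

lemma unbalanced_inI:
  "\<lbrakk>{x, y, z} \<subseteq> Q; distinct [x, y, z]; \<not> balanced f x y z\<rbrakk> \<Longrightarrow> unbalanced_in f Q"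
  unfolding unbalanced_in_def by blast

lemma unbalanced_in_mono: "\<lbrakk>unbalanced_in f Q; Q \<subseteq> Q'\<rbrakk> \<Longrightarrow> unbalanced_in f Q'"
  unfolding unbalanced_in_def by (meson order_trans)

context rank_one_extending
begin

text \<open>If \<open>m\<close> fails to join the columns for the rows \<open>x0\<close>,
  \<open>x0'\<close> at one column of \<open>Y\<close>, transitivity spreads the failure to all of
  \<open>Y\<close>. The five-point condition then makes \<open>m\<close> a row parallel to those of
  \<open>X\<close>.\<close>

lemma vertex_side:
  assumes XY: "X \<subseteq> V" "Y \<subseteq> V" "X \<inter> Y = {}" and m: "m \<in> V - X - Y"
    and p: "\<And>x x' y y'. \<lbrakk>x \<in> X; x' \<in> X; y \<in> Y; y' \<in> Y\<rbrakk> \<Longrightarrow> par a x x' y y'"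
  shows "(\<forall>x\<in>X. \<forall>y\<in>Y. \<forall>y'\<in>Y. par a x m y y') \<or> (\<forall>x\<in>X. \<forall>x'\<in>X. \<forall>y\<in>Y. par a x x' y m)"
proof (rule disjCI)
  assume "\<not> (\<forall>x\<in>X. \<forall>x'\<in>X. \<forall>y\<in>Y. par a x x' y m)"
  then obtain x0 x0' y0 where x0: "x0 \<in> X" "x0' \<in> X" "y0 \<in> Y" "\<not> par a x0 x0' y0 m" by blast
  show "\<forall>x\<in>X. \<forall>y\<in>Y. \<forall>y'\<in>Y. par a x m y y'"
  proof (intro ballI)
    fix x y y' assume h: "x \<in> X" "y \<in> Y" "y' \<in> Y"
    show "par a x m y y'"
    proof (cases "y = y'")
      case False
      have "\<not> par a x0 x0' y m"
        using x0 p[of x0 x0' y0 y] par_trans_col[of x0 x0' y0 y m] h XY by auto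
      moreover have "distinct [x0, x0', y, y', m]" using x0 h False m XY by auto
      moreover have "{x0, x0', y, y', m} \<subseteq> V" using x0 h m XY by auto
      ultimately have "par a x0 m y y'" using extend[of x0 x0' y y' m] p x0 h by blast
      then show ?thesis using par_trans_row[of x x0 y y' m] p[of x x0 y y'] x0 h XY by auto
    qed simp
  qed
qed

text \<open>Here \<open>m\<close> sides with \<open>Y\<close> when the rows are in \<open>X\<close>,
  and with \<open>X\<close> when the rows are in \<open>Y\<close>. The columns parallel to
  \<open>x2\<close> for the rows \<open>k\<close>, \<open>m\<close> form a proper nonempty part
  \<open>P\<close> of \<open>X\<close>. Linkedness gives an unbalanced edge from \<open>i\<close> in
  \<open>P\<close> to \<open>j\<close> outside, which puts \<open>i\<close>, \<open>j\<close>,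
  \<open>k\<close>, \<open>l\<close>, \<open>m\<close> in the situation of
  \<open>uncut_four_of_bad\<close>.\<close>

lemma uncut_four_of_bad_vertex:
  assumes XY: "X \<subseteq> V" "Y \<subseteq> V" "X \<inter> Y = {}" and m: "m \<in> V - X - Y"
    and c: "\<And>x x' y y'. \<lbrakk>x \<in> X; x' \<in> X; y \<in> Y; y' \<in> Y\<rbrakk> \<Longrightarrow> cut4 a x x' y y'"
    and linked: "\<And>P. \<lbrakk>P \<subseteq> X; P \<noteq> {}; P \<noteq> X\<rbrakk> \<Longrightarrow> \<exists>x\<in>P. \<exists>x'\<in>X - P. \<exists>y\<in>Y. \<not> balanced a x x' y"
    and oy: "\<And>x x' y. \<lbrakk>x \<in> X; x' \<in> X; y \<in> Y\<rbrakk> \<Longrightarrow> par a x x' y m"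
    and ix: "\<And>x y y'. \<lbrakk>x \<in> X; y \<in> Y; y' \<in> Y\<rbrakk> \<Longrightarrow> par a y y' x m"
    and nox: "x1 \<in> X" "k \<in> Y" "l \<in> Y" "\<not> par a x1 m k l"
    and niy: "y1 \<in> Y" "x2 \<in> X" "x3 \<in> X" "\<not> par a y1 m x2 x3"
  shows "\<exists>Q\<subseteq>V. card Q = 4 \<and> \<not> (\<exists>X. cutset a Q X) \<and> unbalanced_in a Q"
proof -
  have pc: "par a x x' y y'" "par a y y' x x'" if "x \<in> X" "x' \<in> X" "y \<in> Y" "y' \<in> Y" for x x' y y'
    using c[OF that] by (auto simp: cut4_def)
  have nox': "\<not> par a x m k l" if "x \<in> X" for x
    using nox that pc(1)[of x1 x k l] par_trans_row[of x1 x k l m] XY by auto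
  have niy': "\<not> par a k m x2 x3"
    using niy nox pc(2)[of x2 x3 y1 k] par_trans_row[of y1 k x2 x3 m] XY by auto
  define P where "P = {x \<in> X. par a k m x2 x}"
  have "P \<subseteq> X" "P \<noteq> {}" "P \<noteq> X" using niy niy' by (auto simp: P_def)
  from linked[OF this] obtain i j y where ij: "i \<in> P" "j \<in> X - P" "y \<in> Y" "\<not> balanced a i j y" by blast
  have nij: "\<not> par a k m i j"
    using ij par_trans_col[of k m x2 i j] XY nox m by (auto simp: P_def)
  have iX: "i \<in> X" "j \<in> X" "i \<noteq> j" using ij by (auto simp: P_def)
  have kl: "k \<noteq> l" using nox by auto
  have d: "distinct [i, j, k, l, m]" "{i, j, k, l, m} \<subseteq> V" using iX kl nox m XY by auto
  have nb: "\<not> balanced a i j z" if "z \<in> Y" for z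
  proof (cases "z = y")
    case False
    then show ?thesis using ij cut4_balanced[of i j z y] c[of i j z y] iX that XY by auto
  qed (use ij in simp)
  have "\<not> (\<exists>X. cutset a {i, j, k, m} X) \<or> \<not> (\<exists>X. cutset a {i, j, l, m} X)"
    by (rule uncut_four_of_bad[OF d])
      (use iX nox oy ix pc nox' nij nb in auto)
  moreover have "unbalanced_in a {i, j, k, m}"
    by (rule unbalanced_inI[of i j k]) (use nb[OF nox(2)] d in auto)
  moreover have "unbalanced_in a {i, j, l, m}"
    by (rule unbalanced_inI[of i j l]) (use nb[OF nox(3)] d in auto)
  moreover have "card {i, j, k, m} = 4" "card {i, j, l, m} = 4" using d by auto
  moreover have "{i, j, k, m} \<subseteq> V" "{i, j, l, m} \<subseteq> V" using d by auto
  ultimately show ?thesis by blast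
qed

text \<open>Take a linked cut \<open>(X, Y)\<close> with largest union. An outside index in an
  unbalanced triple across the two sides would join one side, against maximality, or side
  differently in the two blocks and yield the 4-set. Otherwise all such triples are balanced, and
  \<open>par_flip_iff\<close> with \<open>cutset_columns\<close> gives a cut of
  \<open>V\<close>.\<close>

lemma uncut_four_exists:
  assumes noc: "\<not> (\<exists>K. cutset a V K)"
    and d: "distinct [i, j, k, l]" "{i, j, k, l} \<subseteq> V"
    and c: "cut4 a i j k l" "\<not> balanced a i j k"
  shows "\<exists>Q\<subseteq>V. card Q = 4 \<and> \<not> (\<exists>X. cutset a Q X) \<and> unbalanced_in a Q"
proof (rule ccontr)
  assume no4: "\<not> ?thesis"
  have start: "linked_cut {i, j} {k, l}"
  proof (rule linked_cutI)
    fix x x' y y' assume "x \<in> {i, j}" "x' \<in> {i, j}" "y \<in> {k, l}" "y' \<in> {k, l}"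
    then show "cut4 a x x' y y'" using c(1) by (auto simp: cut4_commute)
  next
    show "linked {i, j} {k, l}" unfolding linked_def
    proof (intro allI impI)
      fix P assume "P \<subseteq> {i, j}" "P \<noteq> {} \<and> P \<noteq> {i, j}"
      then have "P = {i} \<or> P = {j}" by blast
      then show "\<exists>x\<in>P. \<exists>x'\<in>{i, j} - P. \<exists>y\<in>{k, l}. \<not> balanced a x x' y"
        using c(2) d by (auto simp: balanced_commute)
    qed
  qed (use d in auto)
  have "\<exists>p. (\<lambda>(X, Y). linked_cut X Y) p \<and>
    (\<forall>q. (\<lambda>(X, Y). linked_cut X Y) q \<longrightarrow> (\<lambda>(X, Y). card (X \<union> Y)) q \<le> (\<lambda>(X, Y). card (X \<union> Y)) p)"
  proof (rule ex_has_greatest_nat[of _ "({i, j}, {k, l})"])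
    show "\<forall>q. (\<lambda>(X, Y). linked_cut X Y) q \<longrightarrow> (\<lambda>(X, Y). card (X \<union> Y)) q < Suc (card V)"
      using finV by (auto intro!: card_mono simp: linked_cut_def less_Suc_eq_le)
  qed (use start in simp)
  then obtain X Y where lc: "linked_cut X Y"
    and max: "\<And>X' Y'. linked_cut X' Y' \<Longrightarrow> card (X' \<union> Y') \<le> card (X \<union> Y)" by auto
  note D = linked_cutD[OF lc]
  have fin: "finite (X \<union> Y)" using D finV finite_subset by auto
  have nbig: "\<not> linked_cut X' Y'" if "X' \<union> Y' = insert m (X \<union> Y)" "m \<notin> X \<union> Y" for X' Y' m
    using max[of X' Y'] that fin by auto
  have neutral: "balanced a x m y"
    if m: "m \<in> V - X - Y" and x: "x \<in> X" and y: "y \<in> Y" for m x y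
  proof (rule ccontr)
    assume nb: "\<not> balanced a x m y"
    have pc: "par a x x' y y'" "par a y y' x x'" if "x \<in> X" "x' \<in> X" "y \<in> Y" "y' \<in> Y" for x x' y y'
      using D(6)[OF that] by (auto simp: cut4_def)
    have out: "(\<forall>x\<in>X. \<forall>y\<in>Y. \<forall>y'\<in>Y. par a x m y y') \<or> (\<forall>x\<in>X. \<forall>x'\<in>X. \<forall>y\<in>Y. par a x x' y m)"
      (is "?OX \<or> ?OY")
      by (rule vertex_side[OF D(1,2,3) m pc(1)])
    have inn: "(\<forall>y\<in>Y. \<forall>x\<in>X. \<forall>x'\<in>X. par a y m x x') \<or> (\<forall>y\<in>Y. \<forall>y'\<in>Y. \<forall>x\<in>X. par a y y' x m)"
      (is "?IY \<or> ?IX")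
      by (rule vertex_side[OF D(2,1) _ _ pc(2)]) (use D(3) m in auto)
    have 1: "\<not> (?OY \<and> ?IY)"
    proof
      assume "?OY \<and> ?IY"
      then have "linked_cut X (insert m Y)"
        using linked_cut_join_right[OF lc m] by (auto simp: cut4_def)
      then show False using nbig[of X "insert m Y" m] m by auto
    qed
    have 2: "\<not> (?OX \<and> ?IX)"
    proof
      assume "?OX \<and> ?IX"
      then have "linked_cut (insert m X) Y"
        using linked_cut_join_left[OF lc m _ x y nb] by (auto simp: cut4_def)
      then show False using nbig[of "insert m X" Y m] m by auto
    qed
    have link: "\<exists>x\<in>P. \<exists>x'\<in>X - P. \<exists>y\<in>Y. \<not> balanced a x x' y" if "P \<subseteq> X" "P \<noteq> {}" "P \<noteq> X" for P
      using D(7) that unfolding linked_def by blast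
    from out inn 1 2 consider "?OY" "?IX" "\<not> ?OX" "\<not> ?IY" | "?OX" "?IY" "\<not> ?OY" "\<not> ?IX" by argo
    then show False
    proof cases
      case 1
      from 1(3) obtain x1 k l where h1: "x1 \<in> X" "k \<in> Y" "l \<in> Y" "\<not> par a x1 m k l" by blast
      from 1(4) obtain y1 x2 x3 where h2: "y1 \<in> Y" "x2 \<in> X" "x3 \<in> X" "\<not> par a y1 m x2 x3" by blast
      have "\<exists>Q\<subseteq>V. card Q = 4 \<and> \<not> (\<exists>X. cutset a Q X) \<and> unbalanced_in a Q"
        by (rule uncut_four_of_bad_vertex[OF D(1,2,3) m D(6) link _ _ h1 h2]) (use 1(1,2) in auto)
      then show False using no4 by contradiction
    next
      case 2
      \<comment> \<open>Transposition exchanges the two ways in which the sides of \<open>m\<close>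
        can disagree, while cuts and balance are invariant.\<close>
      interpret T: rank_one_extending "flip_args a" V by (rule transpose)
      from 2(4) obtain x1 k l where h1: "x1 \<in> X" "k \<in> Y" "l \<in> Y" "\<not> par a k l x1 m" by blast
      from 2(3) obtain y1 x2 x3 where h2: "y1 \<in> Y" "x2 \<in> X" "x3 \<in> X" "\<not> par a x2 x3 y1 m" by blast
      have "\<exists>Q\<subseteq>V. card Q = 4 \<and> \<not> (\<exists>X. cutset (flip_args a) Q X) \<and> unbalanced_in (flip_args a) Q"
        by (rule T.uncut_four_of_bad_vertex[OF D(1,2,3) m _ _ _ _ h1(1-3) _ h2(1-3)])
          (use D(6) link 2(1,2) h1 h2 in \<open>auto simp: cut4_transpose balanced_transpose par_transpose\<close>)
      then show False using no4
        by (simp add: cutset_transpose unbalanced_in_def balanced_transpose)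
    qed
  qed
  obtain x0 x1 where x: "x0 \<in> X" "x1 \<in> X" "x0 \<noteq> x1" using D(4) by blast
  obtain y0 y1 where y: "y0 \<in> Y" "y1 \<in> Y" "y0 \<noteq> y1" using D(5) by blast
  have iff: "par a x x' y0 v \<longleftrightarrow> par a y0 v x x'" if v: "v \<in> V - X" and xx: "x \<in> X" "x' \<in> X" for v x x'
  proof -
    consider "v \<in> Y" | "x = x'" | "v \<notin> Y" "x \<noteq> x'" by blast
    then show ?thesis
    proof cases
      case 1 then show ?thesis using D(6)[OF xx y(1) 1] by (simp add: cut4_def)
    next
      case 3
      have dd: "distinct [x, x', y0, v]" "{x, x', y0, v} \<subseteq> V" using 3 v xx y D by auto
      have "balanced a x y0 v" "balanced a x' y0 v"
        using neutral[of v x y0] neutral[of v x' y0] v 3 xx y by (auto simp: balanced_commute)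
      then show ?thesis using par_flip_iff[OF dd] balanced_two[OF dd] by simp
    qed simp
  qed
  have "\<exists>K. cutset a V K \<and> y0 \<in> K \<and> y1 \<in> K \<and> K \<inter> X = {}"
    by (rule cutset_columns[OF D(1) order_refl _ _ y(3) x]) (use D y iff in auto)
  then show False using noc by blast
qed

end

section \<open>Triples of two matrices with equal minors of order at most four\<close>

definition same :: "('v \<Rightarrow> 'v \<Rightarrow> 'a::field) \<Rightarrow> ('v \<Rightarrow> 'v \<Rightarrow> 'a) \<Rightarrow> 'v \<Rightarrow> 'v \<Rightarrow> 'v \<Rightarrow> bool" where
  "same f g i j k \<longleftrightarrow> cyc g i j k = cyc f i j k \<and> cyc g i k j = cyc f i k j"

definition turned :: "('v \<Rightarrow> 'v \<Rightarrow> 'a::field) \<Rightarrow> ('v \<Rightarrow> 'v \<Rightarrow> 'a) \<Rightarrow> 'v \<Rightarrow> 'v \<Rightarrow> 'v \<Rightarrow> bool" where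
  "turned f g i j k \<longleftrightarrow> cyc g i j k = cyc f i k j \<and> cyc g i k j = cyc f i j k"

text \<open>The sum of the six 4-cycle products on \<open>{i, j, k, l}\<close>.\<close>

definition quad :: "('v \<Rightarrow> 'v \<Rightarrow> 'a::field) \<Rightarrow> 'v \<Rightarrow> 'v \<Rightarrow> 'v \<Rightarrow> 'v \<Rightarrow> 'a" where
  "quad f i j k l =
     f i j * f j k * f k l * f l i + f i l * f l k * f k j * f j i +
     (f i j * f j l * f l k * f k i + f i k * f k l * f l j * f j i) +
     (f i k * f k j * f j l * f l i + f i l * f l j * f j k * f k i)"

text \<open>Negation encodes strictness: by \<open>same_or_turned\<close>, a triple that is not
  turned is strictly same, and conversely.\<close>

definition mixed :: "('v \<Rightarrow> 'v \<Rightarrow> 'a::field) \<Rightarrow> ('v \<Rightarrow> 'v \<Rightarrow> 'a) \<Rightarrow> 'v \<Rightarrow> 'v \<Rightarrow> 'v \<Rightarrow> 'v \<Rightarrow> bool" where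
  "mixed f g i j k l \<longleftrightarrow> cut4 f i j k l \<and>
     (\<not> turned f g i j k \<and> \<not> turned f g i j l \<and> \<not> same f g i k l \<and> \<not> same f g j k l \<or>
      \<not> same f g i j k \<and> \<not> same f g i j l \<and> \<not> turned f g i k l \<and> \<not> turned f g j k l)"

lemma same_commute: "same f g i j k = same f g j i k" "same f g i j k = same f g i k j"
proof -
  have "cyc h j i k = cyc h i k j" "cyc h j k i = cyc h i j k" for h :: "'a \<Rightarrow> 'a \<Rightarrow> 'b"
    by (simp_all add: cyc_def mult_ac)
  then show "same f g i j k = same f g j i k" "same f g i j k = same f g i k j"
    unfolding same_def by metis+
qed

lemma turned_flip: "turned f g i j k = same f (flip_args g) i j k"
  by (auto simp: turned_def same_def cyc_transpose)

lemma same_flip: "same f g i j k = turned f (flip_args g) i j k"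
  by (auto simp: turned_def same_def cyc_transpose)

lemma turned_commute: "turned f g i j k = turned f g j i k" "turned f g i j k = turned f g i k j"
  unfolding turned_flip by (rule same_commute)+

lemma same_flip_both: "same (flip_args f) (flip_args g) = same f g"
  by (auto simp: same_def cyc_transpose fun_eq_iff)

text \<open>This recovers the triple avoiding \<open>i\<close> from the three triples through
  \<open>i\<close>, up to 2-cycle products.\<close>

lemma cyc_product:
  "cyc f i j k * cyc f i k l * cyc f i l j = (f i j * f j i) * (f i k * f k i) * (f i l * f l i) * cyc f j k l"
  by (simp add: cyc_def mult_ac)

text \<open>Two 3-cycles that run through an edge at \<open>i\<close> in opposite directions merge
  into a 4-cycle once the 2-cycle of that edge is divided out. So \<open>quad\<close> is determined
  by the 2-cycles and 3-cycles through \<open>i\<close>.\<close>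

lemma quad_cyc:
  assumes "f i j * f j i \<noteq> 0" "f i k * f k i \<noteq> 0" "f i l * f l i \<noteq> 0"
  shows "quad f i j k l =
     (cyc f i j k * cyc f i k l + cyc f i l k * cyc f i k j) / (f i k * f k i) +
     (cyc f i j l * cyc f i l k + cyc f i k l * cyc f i l j) / (f i l * f l i) +
     (cyc f i k j * cyc f i j l + cyc f i l j * cyc f i j k) / (f i j * f j i)"
proof -
  have 1: "(cyc f i x y * cyc f i y z + cyc f i z y * cyc f i y x) / (f i y * f y i) =
    f i x * f x y * f y z * f z i + f i z * f z y * f y x * f x i" if "f i y * f y i \<noteq> 0" for x y z
  proof -
    have "cyc f i x y * cyc f i y z + cyc f i z y * cyc f i y x =
      (f i x * f x y * f y z * f z i + f i z * f z y * f y x * f x i) * (f i y * f y i)"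
      by (simp add: cyc_def algebra_simps)
    then show ?thesis using that by simp
  qed
  show ?thesis unfolding quad_def 1[OF assms(1)] 1[OF assms(2)] 1[OF assms(3)] by simp
qed

text \<open>Once the diagonals agree, these are the relations that minors of order two, three and
  four contribute beyond those of smaller order.\<close>

locale minors4 = rank_one_extending a V
  for a :: "'v \<Rightarrow> 'v \<Rightarrow> 'a::field" and V :: "'v set" +
  fixes b :: "'v \<Rightarrow> 'v \<Rightarrow> 'a"
  assumes two: "\<lbrakk>x \<in> V; y \<in> V; x \<noteq> y\<rbrakk> \<Longrightarrow> b x y * b y x = a x y * a y x"
    and three: "\<lbrakk>distinct [i, j, k]; {i, j, k} \<subseteq> V\<rbrakk>
      \<Longrightarrow> cyc b i j k + cyc b i k j = cyc a i j k + cyc a i k j"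
    and four: "\<lbrakk>distinct [i, j, k, l]; {i, j, k, l} \<subseteq> V\<rbrakk> \<Longrightarrow> quad b i j k l = quad a i j k l"
begin

abbreviation sm :: "'v \<Rightarrow> 'v \<Rightarrow> 'v \<Rightarrow> bool" where "sm \<equiv> same a b"
abbreviation tr :: "'v \<Rightarrow> 'v \<Rightarrow> 'v \<Rightarrow> bool" where "tr \<equiv> turned a b"

text \<open>Transposing \<open>b\<close> alone preserves the hypotheses and exchanges same with
  turned, so each result on one kind gives the result on the other.\<close>

lemma flip_b: "minors4 a V (flip_args b)"
proof
  fix i j k l assume d: "distinct [i, j, k, l]" "{i, j, k, l} \<subseteq> V"
  have "quad (flip_args b) i j k l = quad b i j k l"
    by (simp add: quad_def flip_args_def mult_ac add_ac)
  then show "quad (flip_args b) i j k l = quad a i j k l" using four[OF d] by simp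
next
  fix i j k assume d: "distinct [i, j, k]" "{i, j, k} \<subseteq> V"
  then show "cyc (flip_args b) i j k + cyc (flip_args b) i k j = cyc a i j k + cyc a i k j"
    using three[OF d] by (simp add: cyc_transpose add.commute)
qed (use two in \<open>auto simp: flip_args_def mult.commute\<close>)

lemma flip_both: "minors4 (flip_args a) V (flip_args b)"
proof -
  interpret T: rank_one_extending "flip_args a" V by (rule transpose)
  show ?thesis
  proof
    fix i j k l assume d: "distinct [i, j, k, l]" "{i, j, k, l} \<subseteq> V"
    have "quad (flip_args f) i j k l = quad f i j k l" for f :: "'v \<Rightarrow> 'v \<Rightarrow> 'a"
      by (simp add: quad_def flip_args_def mult_ac add_ac)
    then show "quad (flip_args b) i j k l = quad (flip_args a) i j k l" using four[OF d] by simp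
  next
    fix i j k assume d: "distinct [i, j, k]" "{i, j, k} \<subseteq> V"
    then show "cyc (flip_args b) i j k + cyc (flip_args b) i k j =
        cyc (flip_args a) i j k + cyc (flip_args a) i k j"
      using three[OF d] by (simp add: cyc_transpose add.commute)
  qed (use two in \<open>auto simp: flip_args_def mult.commute\<close>)
qed

text \<open>The two orientations have equal sum by \<open>three\<close> and equal product by
  \<open>two\<close>, so for both matrices they are the roots of one quadratic polynomial.\<close>

lemma same_or_turned:
  assumes d: "distinct [i, j, k]" "{i, j, k} \<subseteq> V"
  shows "sm i j k \<or> tr i j k"
proof -
  let ?x = "cyc b i j k" and ?y = "cyc b i k j" and ?u = "cyc a i j k" and ?v = "cyc a i k j"
  have s: "?x + ?y = ?u + ?v" by (rule three[OF d])
  have m: "cyc f i j k * cyc f i k j = (f i j * f j i) * (f j k * f k j) * (f i k * f k i)"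
    for f :: "'v \<Rightarrow> 'v \<Rightarrow> 'a" by (simp add: cyc_def mult_ac)
  have p: "?x * ?y = ?u * ?v" unfolding m using two[of i j] two[of j k] two[of i k] d by simp
  have "(?x - ?u) * (?x - ?v) = ?x * ?x - (?u + ?v) * ?x + ?u * ?v" by (simp add: algebra_simps)
  also have "\<dots> = 0" unfolding s[symmetric] p[symmetric] by (simp add: algebra_simps)
  finally have "?x = ?u \<or> ?x = ?v" by simp
  then show ?thesis using s by (auto simp: same_def turned_def)
qed

lemma balanced_same_turned:
  "\<lbrakk>distinct [i, j, k]; {i, j, k} \<subseteq> V\<rbrakk> \<Longrightarrow> balanced a i j k \<longleftrightarrow> sm i j k \<and> tr i j k"
  using same_or_turned[of i j k] by (auto simp: same_def turned_def balanced_def)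

text \<open>In \<open>cyc_product\<close> the 2-cycles agree for both matrices and are nonzero, so
  they can be cancelled.\<close>

lemma same_fourth:
  assumes d: "distinct [i, j, k, l]" "{i, j, k, l} \<subseteq> V"
    and s: "sm i j k" "sm i k l" "sm i j l"
  shows "sm j k l"
proof -
  have n: "a i j * a j i * (a i k * a k i) * (a i l * a l i) \<noteq> 0" using d nz by auto
  have n2: "b i j * b j i = a i j * a j i" "b i k * b k i = a i k * a k i" "b i l * b l i = a i l * a l i"
    using two d by auto
  have "cyc b i j k * cyc b i k l * cyc b i l j = cyc a i j k * cyc a i k l * cyc a i l j"
    "cyc b i k j * cyc b i j l * cyc b i l k = cyc a i k j * cyc a i j l * cyc a i l k"
    using s by (auto simp: same_def)
  then have "cyc b j k l = cyc a j k l" "cyc b k j l = cyc a k j l"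
    unfolding cyc_product n2 using n by (auto simp: mult_ac)
  moreover have "cyc f k j l = cyc f j l k" for f :: "'v \<Rightarrow> 'v \<Rightarrow> 'a" by (simp add: cyc_def mult_ac)
  ultimately show ?thesis by (simp add: same_def)
qed

lemma turned_fourth:
  assumes d: "distinct [i, j, k, l]" "{i, j, k, l} \<subseteq> V"
    and s: "tr i j k" "tr i k l" "tr i j l"
  shows "tr j k l"
  using minors4.same_fourth[OF flip_b d] s by (simp add: turned_flip)

text \<open>
  With \<open>P\<close>, \<open>K\<close>, \<open>L\<close> the 3-cycle products through \<open>i\<close> and a prime for reversal, the fourth order
  minors give \<open>(P - P') (Nj (K' - K) - Nk (L - L')) = 0\<close>, and the triple \<open>{j, k, l}\<close> gives
  \<open>K L = K' L'\<close>. Hence \<open>L = L'\<close> or \<open>Nj K' = Nk L\<close>, and the latter says that \<open>{i, l}\<close> is a cut.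
\<close>

lemma one_turned:
  assumes d: "distinct [i, j, k, l]" "{i, j, k, l} \<subseteq> V"
    and s: "\<not> sm i j k" "sm i j l" "sm i k l"
  shows "tr i j k \<and> tr i j l \<and> tr i k l \<and> tr j k l \<or>
    cut4 a i l j k \<and> \<not> sm i j k \<and> \<not> sm j k l \<and> \<not> tr i j l \<and> \<not> tr i k l"
proof -
  have dijk: "distinct [i, j, k]" "{i, j, k} \<subseteq> V" and dijl: "distinct [i, j, l]" "{i, j, l} \<subseteq> V"
    and dikl: "distinct [i, k, l]" "{i, k, l} \<subseteq> V" and djkl: "distinct [j, k, l]" "{j, k, l} \<subseteq> V"
    using d by auto
  have t: "tr i j k" using same_or_turned[OF dijk] s by simp
  have nsj: "\<not> sm j k l"
    using same_fourth[of l i j k] s d by (auto simp: same_commute)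
  then have tj: "tr j k l" using same_or_turned[OF djkl] by simp
  define P where "P = cyc a i j k" define P' where "P' = cyc a i k j"
  define K where "K = cyc a i k l" define K' where "K' = cyc a i l k"
  define L where "L = cyc a i l j" define L' where "L' = cyc a i j l"
  define Nj where "Nj = a i j * a j i" define Nk where "Nk = a i k * a k i"
  define Nl where "Nl = a i l * a l i"
  have z: "Nj \<noteq> 0" "Nk \<noteq> 0" "Nl \<noteq> 0" "P' \<noteq> 0" "K' \<noteq> 0" "L \<noteq> 0"
    using d nz cyc_nz by (auto simp: Nj_def Nk_def Nl_def P'_def K'_def L_def)
  have bN: "b i j * b j i = Nj" "b i k * b k i = Nk" "b i l * b l i = Nl"
    using two d by (auto simp: Nj_def Nk_def Nl_def)
  have bc: "cyc b i j k = P'" "cyc b i k j = P" "cyc b i k l = K" "cyc b i l k = K'"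
    "cyc b i l j = L" "cyc b i j l = L'"
    using s t by (auto simp: P_def P'_def K_def K'_def L_def L'_def same_def turned_def)
  have P: "P \<noteq> P'" using s(1) t by (auto simp: P_def P'_def same_def turned_def)
  have "P' * K * L = Nj * Nk * Nl * cyc a j l k"
    using cyc_product[of b i j k l] tj unfolding bc bN by (simp add: turned_def)
  moreover have "L' * K' * P' = Nj * Nl * Nk * cyc a j l k"
    using cyc_product[of a i j l k] unfolding L'_def K'_def P'_def Nj_def Nl_def Nk_def .
  ultimately have "P' * (K * L) = P' * (K' * L')" by (simp add: mult_ac)
  then have KL: "K * L = K' * L'" using z by simp
  have qa: "quad a i j k l = (P * K + K' * P') / Nk + (L' * K' + K * L) / Nl + (P' * L' + L * P) / Nj"
    using quad_cyc[of a i j k l] z unfolding P_def P'_def K_def K'_def L_def L'_def Nj_def Nk_def Nl_def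
    by simp
  have qb: "quad b i j k l = (P' * K + K' * P) / Nk + (L' * K' + K * L) / Nl + (P * L' + L * P') / Nj"
    using quad_cyc[of b i j k l] z unfolding bc bN by simp
  have "(P * K + K' * P') / Nk + (P' * L' + L * P) / Nj = (P' * K + K' * P) / Nk + (P * L' + L * P') / Nj"
    using four[OF d] unfolding qa qb by (simp add: algebra_simps)
  then have "(P - P') * (Nj * (K' - K) - Nk * (L - L')) = 0"
    using z by (simp add: field_simps)
  then have e: "Nj * (K' - K) = Nk * (L - L')" using P by simp
  have "(L - L') * (Nj * K' - Nk * L) = Nj * (K' * L - K' * L') - L * (Nk * (L - L'))"
    by (simp add: algebra_simps)
  also have "\<dots> = Nj * (K' * L - K * L) - L * (Nj * (K' - K))" by (simp only: KL e)
  also have "\<dots> = 0" by (simp add: algebra_simps)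
  finally have "(L - L') * (Nj * K' - Nk * L) = 0" .
  then consider "L = L'" | "Nj * K' = Nk * L" by auto
  then show ?thesis
  proof cases
    case 1
    then have "balanced a i l j" "balanced a i k l"
      using KL z by (auto simp: balanced_def L_def L'_def K_def K'_def)
    then have "balanced a i j l" "balanced a i k l" by (simp_all add: balanced_commute)
    then show ?thesis using balanced_same_turned[OF dijl] balanced_same_turned[OF dikl] t tj by simp
  next
    case 2
    have "L * (Nj * K) = Nj * (K * L)" by (simp add: mult_ac)
    also have "\<dots> = (Nj * K') * L'" unfolding KL by (simp add: mult_ac)
    also have "\<dots> = L * (Nk * L')" unfolding 2 by (simp add: mult_ac)
    finally have 3: "Nj * K = Nk * L'" using z by simp
    have "(a i j * a l k) * (a j i * a i l * a k i) = (a i k * a l j) * (a j i * a i l * a k i)"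
      using 2 by (simp add: Nj_def Nk_def K'_def L_def cyc_def mult_ac)
    moreover have "a j i * a i l * a k i \<noteq> 0" using d nz by auto
    ultimately have p1: "par a i l j k" unfolding par_def by simp
    have "(a j i * a k l) * (a i j * a i k * a l i) = (a j l * a k i) * (a i j * a i k * a l i)"
      using 3 by (simp add: Nj_def Nk_def K_def L'_def cyc_def mult_ac)
    moreover have "a i j * a i k * a l i \<noteq> 0" using d nz by auto
    ultimately have p2: "par a j k i l" unfolding par_def by simp
    have c: "cut4 a i l j k" using p1 p2 by (simp add: cut4_def)
    have "balanced a i j l \<longleftrightarrow> balanced a i k l"
      using cut4_balanced[of i l j k] c d by (auto simp: balanced_commute)
    then show ?thesis
      using balanced_same_turned[OF dijl] balanced_same_turned[OF dikl] t tj c s nsj by blast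
  qed
qed

text \<open>If the three triples through \<open>i\<close> share a kind, the fourth follows.
  Otherwise exactly one of them lacks a kind common to the other two, and \<open>one_turned\<close>
  applies after permuting \<open>j\<close>, \<open>k\<close>, \<open>l\<close> and possibly
  transposing \<open>b\<close>.\<close>

lemma fourset:
  assumes d: "distinct [i, j, k, l]" "{i, j, k, l} \<subseteq> V"
  shows "sm i j k \<and> sm i j l \<and> sm i k l \<and> sm j k l \<or> tr i j k \<and> tr i j l \<and> tr i k l \<and> tr j k l \<or>
    mixed a b i j k l \<or> mixed a b i k j l \<or> mixed a b i l j k"
proof -
  interpret F: minors4 a V "flip_args b" by (rule flip_b)
  note c = same_commute turned_commute cut4_commute cut4_flip
  have d': "distinct [i, j, l, k]" "{i, j, l, k} \<subseteq> V" "distinct [i, k, l, j]" "{i, k, l, j} \<subseteq> V"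
    using d by auto
  have st: "sm i j k \<or> tr i j k" "sm i j l \<or> tr i j l" "sm i k l \<or> tr i k l"
    using same_or_turned d by auto
  note o1 = one_turned[OF d] one_turned[OF d'(1,2)] one_turned[OF d'(3,4)]
  note o2 = F.one_turned[OF d, folded turned_flip same_flip]
    F.one_turned[OF d'(1,2), folded turned_flip same_flip]
    F.one_turned[OF d'(3,4), folded turned_flip same_flip]
  note f = same_fourth[OF d] turned_fourth[OF d]
  show ?thesis using st o1 o2 f
    unfolding mixed_def by (simp add: c) argo
qed

section \<open>Sets of one kind and the existence of a mixed 4-set\<close>

definition all_same :: "'v set \<Rightarrow> bool" where
  "all_same Z \<longleftrightarrow> (\<forall>x y z. {x, y, z} \<subseteq> Z \<longrightarrow> distinct [x, y, z] \<longrightarrow> sm x y z)"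

definition all_turned :: "'v set \<Rightarrow> bool" where
  "all_turned Z \<longleftrightarrow> (\<forall>x y z. {x, y, z} \<subseteq> Z \<longrightarrow> distinct [x, y, z] \<longrightarrow> tr x y z)"

lemma all_sameD: "\<lbrakk>all_same Z; x \<in> Z; y \<in> Z; z \<in> Z; x \<noteq> y; x \<noteq> z; y \<noteq> z\<rbrakk> \<Longrightarrow> sm x y z"
  by (auto simp: all_same_def)

text \<open>Without mixed 4-sets every 4-set has a single kind. Some \<open>p\<close> lies in a
  strictly same triple \<open>{p, j, k}\<close> and a strictly turned triple
  \<open>{p, l, m}\<close>. By \<open>adj\<close> the five indices are distinct,
  \<open>{p, j, l}\<close> and \<open>{p, k, l}\<close> are balanced and \<open>{p, j, m}\<close> is
  same. Then \<open>{j, k, l}\<close> is not turned and \<open>{j, l, m}\<close> is not same,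
  although both lie in one 4-set.\<close>

lemma mixed_exists:
  assumes ns: "\<not> all_same V" and nt: "\<not> all_turned V"
  shows "\<exists>i j k l. distinct [i, j, k, l] \<and> {i, j, k, l} \<subseteq> V \<and> mixed a b i j k l"
proof (rule ccontr)
  assume no: "\<not> ?thesis"
  have coh: "sm i j k \<and> sm i j l \<and> sm i k l \<and> sm j k l \<or> tr i j k \<and> tr i j l \<and> tr i k l \<and> tr j k l"
    if d: "distinct [i, j, k, l]" "{i, j, k, l} \<subseteq> V" for i j k l
  proof -
    have "\<not> mixed a b i j k l" "\<not> mixed a b i k j l" "\<not> mixed a b i l j k" using no d by auto
    then show ?thesis using fourset[OF d] by blast
  qed
  obtain p j k where r: "{p, j, k} \<subseteq> V" "distinct [p, j, k]" "\<not> tr p j k"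
    using nt by (auto simp: all_turned_def)
  obtain x y z where u: "{x, y, z} \<subseteq> V" "distinct [x, y, z]" "\<not> sm x y z"
    using ns by (auto simp: all_same_def)
  have "\<exists>l m. {p, l, m} \<subseteq> V \<and> distinct [p, l, m] \<and> \<not> sm p l m"
  proof (rule ccontr)
    assume "\<not> ?thesis"
    then have *: "sm p l m" if "{p, l, m} \<subseteq> V" "distinct [p, l, m]" for l m using that by blast
    show False
    proof (cases "p \<in> {x, y, z}")
      case True
      then show False using *[of x y] *[of y z] *[of x z] u r by (auto simp: same_commute)
    next
      case False
      then show False using same_fourth[of p x y z] *[of x y] *[of y z] *[of x z] u r by auto
    qed
  qed
  then obtain l m where b: "{p, l, m} \<subseteq> V" "distinct [p, l, m]" "\<not> sm p l m" by blast
  have adj: False if "\<not> tr p x y" "\<not> sm p x z" "{p, x, y, z} \<subseteq> V" "distinct [p, x, y]" "distinct [p, x, z]" for x y z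
  proof (cases "y = z")
    case True then show False using same_or_turned[of p x y] that by auto
  next
    case False then show False using coh[of p x y z] that by auto
  qed
  note c = same_commute turned_commute
  have rk: "\<not> tr p k j" using r by (simp add: c)
  have bm: "\<not> sm p m l" using b by (simp add: c)
  have ne: "distinct [p, j, k, l, m]" "{p, j, k, l, m} \<subseteq> V"
    using adj[OF r(3), of l] adj[OF r(3), of m] adj[OF rk, of l] adj[OF rk, of m] r b bm by auto
  have "tr p j l" using adj[of l j m] b(3) ne by (auto simp: c)
  moreover have "sm p j l" using adj[of j k l] r(3) ne by (auto simp: c)
  moreover have "tr p k l" using adj[of l k m] b(3) ne by (auto simp: c)
  moreover have "sm p k l" using adj[of k j l] rk ne by (auto simp: c)
  moreover have "sm p j m" using adj[of j k m] r(3) ne by (auto simp: c)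
  ultimately have w: "tr p j l" "sm p j l" "tr p k l" "sm p k l" "sm p j m" by auto
  have 1: "\<not> tr j k l"
    using turned_fourth[of l j k p] w r ne by (auto simp: c)
  have 2: "\<not> sm j l m"
    using same_fourth[of j l m p] w b ne by (auto simp: c)
  show False using coh[of j k l m] 1 2 ne by auto
qed

text \<open>The 4-set \<open>{m, x, x', u}\<close> has triples of both strict kinds, hence is mixed.
  As \<open>{x, x', u}\<close> is same, the only possible split is \<open>{x, x'}\<close> against
  \<open>{m, u}\<close>.\<close>

lemma link_step:
  assumes Z: "Z \<subseteq> V" "all_same Z" "m \<in> V - Z"
    and x: "x \<in> Z" "x' \<in> Z" "u \<in> Z" "x \<noteq> x'" "x \<noteq> u" "\<not> tr m x x'" "\<not> sm m x u"
  shows "x' \<noteq> u \<and> \<not> sm m x' u \<and> cut4 a x x' m u"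
proof -
  have "x' \<noteq> u"
    using same_or_turned[of m x x'] x Z by auto
  moreover have d: "distinct [m, x, x', u]" "{m, x, x', u} \<subseteq> V" using x Z calculation by auto
  moreover have "sm x x' u" using all_sameD[OF Z(2)] x calculation by auto
  moreover have "sm m x x'" "tr m x u" using same_or_turned[of m x x'] same_or_turned[of m x u] x d by auto
  ultimately show ?thesis using fourset[OF d] x cut4_flip[of a m u x x']
    unfolding mixed_def by (auto simp: same_commute turned_commute)
qed

section \<open>Adding indices to an uncut set\<close>

definition link :: "'v set \<Rightarrow> 'v \<Rightarrow> ('v \<times> 'v) set" where
  "link Z m = {(x, x'). x \<in> Z \<and> x' \<in> Z \<and> x \<noteq> x' \<and> \<not> tr m x x'}"

text \<open>Along a path of strictly same pairs, strict turning with \<open>u\<close> persists, and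
  the cuts from \<open>link_step\<close> compose by transitivity.\<close>

lemma link_const:
  assumes Z: "Z \<subseteq> V" "all_same Z" "m \<in> V - Z"
    and "(x, x') \<in> (link Z m)\<^sup>*" and u: "x \<in> Z" "u \<in> Z" "x \<noteq> u" "\<not> sm m x u"
  shows "x' \<in> Z \<and> x' \<noteq> u \<and> \<not> sm m x' u \<and> cut4 a x x' m u"
  using assms(4)
proof (induction rule: rtrancl_induct)
  case base
  then show ?case using u by simp
next
  case (step y z)
  have yz: "y \<in> Z" "z \<in> Z" "y \<noteq> z" "\<not> tr m y z" using step.hyps by (auto simp: link_def)
  have s: "z \<noteq> u \<and> \<not> sm m z u \<and> cut4 a y z m u"
    by (rule link_step[OF Z]) (use yz step.IH u in auto)
  moreover have "cut4 a x z m u"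
    by (rule cut4_trans[of x y]) (use s step.IH yz u Z in auto)
  ultimately show ?case using yz by simp
qed

text \<open>The rows \<open>X\<close> are the component of \<open>x2\<close> in the graph of
  strictly same pairs. If some element of \<open>X\<close> is strictly turned with \<open>v\<close>,
  then all are, and \<open>{m, v}\<close> is opposite to \<open>X\<close> in cuts
  (\<open>blue\<close>); otherwise all triples \<open>{x, m, v}\<close> are balanced
  (\<open>white\<close>). Either way the condition of \<open>cutset_columns\<close> holds.\<close>

lemma cutset_of_link:
  assumes Z: "Z \<subseteq> V" "all_same Z" "m \<in> V - Z"
    and x: "x1 \<in> Z" "x2 \<in> Z" "u \<in> Z" "x1 \<noteq> x2" "x2 \<noteq> u" "\<not> tr m x1 x2" "\<not> sm m x2 u"
  shows "\<exists>K. cutset a (insert m Z) K \<and> m \<in> K \<and> u \<in> K \<and> x1 \<notin> K \<and> x2 \<notin> K"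
proof -
  define X where "X = {x \<in> Z. (x2, x) \<in> (link Z m)\<^sup>*}"
  have "sym (link Z m)" by (auto simp: sym_def link_def turned_commute)
  then have sy: "sym ((link Z m)\<^sup>*)" by (rule sym_rtrancl)
  have conn: "(x, x') \<in> (link Z m)\<^sup>*" if "x \<in> X" "x' \<in> X" for x x'
    using that sy unfolding X_def sym_def by (metis (mono_tags, lifting) mem_Collect_eq rtrancl_trans)
  have x2X: "x2 \<in> X" using x by (simp add: X_def)
  have "(x2, x1) \<in> link Z m" using x by (auto simp: link_def turned_commute)
  then have x1X: "x1 \<in> X" using x by (auto simp: X_def)
  have uX: "u \<notin> X" using link_const[OF Z, of x2 u u] x by (auto simp: X_def)
  have XZ: "X \<subseteq> Z" by (auto simp: X_def)
  have blue: "cut4 a x x' m v" if "v \<in> Z - X" "z \<in> X" "\<not> sm m z v" "x \<in> X" "x' \<in> X" for v z x x'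
  proof -
    have "\<not> sm m x v \<and> x \<noteq> v" using link_const[OF Z conn[of z x], of v] that XZ by auto
    then show ?thesis using link_const[OF Z conn[of x x'], of v] that XZ by auto
  qed
  have white: "balanced a x m v" if "v \<in> Z - X" "x \<in> X" "sm m x v" for v x
  proof -
    have "(x, v) \<notin> link Z m" using that by (auto simp: X_def intro: rtrancl_into_rtrancl)
    then have "tr m x v" using that XZ by (auto simp: link_def)
    then have "balanced a m x v" using balanced_same_turned[of m x v] that XZ Z by auto
    then show ?thesis by (simp add: balanced_commute)
  qed
  have iff: "(\<forall>x\<in>X. \<forall>x'\<in>X. par a x x' m v) \<longleftrightarrow> (\<forall>x\<in>X. \<forall>x'\<in>X. par a m v x x')"
    if v: "v \<in> insert m Z - X" for v
  proof -
    consider "v = m" | "v \<in> Z" "\<exists>z\<in>X. \<not> sm m z v" | "v \<in> Z" "\<forall>z\<in>X. sm m z v" using v by blast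
    then show ?thesis
    proof cases
      case 2
      then show ?thesis using blue v by (auto simp: cut4_def)
    next
      case 3
      have "par a x x' m v \<longleftrightarrow> par a m v x x'" if "x \<in> X" "x' \<in> X" for x x'
      proof (cases "x = x'")
        case False
        have d: "distinct [x, x', m, v]" "{x, x', m, v} \<subseteq> V" using False that v 3 XZ Z by auto
        show ?thesis
          using par_flip_iff[OF d] balanced_two[OF d] white[of v x] white[of v x'] that v 3 by auto
      qed simp
      then show ?thesis by blast
    qed simp
  qed
  have "\<exists>K. cutset a (insert m Z) K \<and> m \<in> K \<and> u \<in> K \<and> K \<inter> X = {}"
    by (rule cutset_columns[OF _ _ _ _ _ x1X x2X])
      (use XZ Z uX x x2X blue[of u x2] iff in auto)
  then show ?thesis using x1X x2X by blast
qed

text \<open>An unbalanced triple of \<open>Z\<close> is not turned, which yields a strictly same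
  pair in the link of \<open>m\<close>. If a strictly turned pair \<open>{p, p'}\<close> had
  balanced triples with both \<open>m\<close> and \<open>x1\<close>, \<open>same_fourth\<close>
  would make \<open>{m, p, p'}\<close> same. Hence pairs of the two strict kinds meet
  somewhere.\<close>

lemma link_exists:
  assumes Z: "Z \<subseteq> V" "all_same Z" "m \<in> V - Z" and ub: "unbalanced_in a Z"
    and n: "\<not> all_same (insert m Z)"
  shows "\<exists>x1 x2. x1 \<in> Z \<and> x2 \<in> Z \<and> x1 \<noteq> x2 \<and> \<not> tr m x1 x2"
    and "\<exists>x1 x2 u. x1 \<in> Z \<and> x2 \<in> Z \<and> u \<in> Z \<and> x1 \<noteq> x2 \<and> x2 \<noteq> u \<and> \<not> tr m x1 x2 \<and> \<not> sm m x2 u"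
    and "\<And>p p' x1. \<lbrakk>p \<in> Z; p' \<in> Z; p \<noteq> p'; \<not> sm m p p'; x1 \<in> Z\<rbrakk>
      \<Longrightarrow> x1 = p \<or> x1 = p' \<or> \<not> sm m p x1 \<or> \<not> tr m p x1 \<or> \<not> sm m p' x1 \<or> \<not> tr m p' x1"
proof -
  note c = same_commute turned_commute
  obtain x y z where xyz: "{x, y, z} \<subseteq> Z" "distinct [x, y, z]" "\<not> balanced a x y z"
    using ub by (auto simp: unbalanced_in_def)
  have sxyz: "sm x y z" using all_sameD[OF Z(2)] xyz by auto
  then have txyz: "\<not> tr x y z" using balanced_same_turned[of x y z] xyz Z by auto
  show A: "\<exists>x1 x2. x1 \<in> Z \<and> x2 \<in> Z \<and> x1 \<noteq> x2 \<and> \<not> tr m x1 x2"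
  proof (rule ccontr)
    assume "\<not> ?thesis"
    then have "tr m x y" "tr m y z" "tr m x z" using xyz by auto
    then have "tr x y z" using turned_fourth[of m x y z] xyz Z by auto
    then show False using txyz by simp
  qed
  show B: "x1 = p \<or> x1 = p' \<or> \<not> sm m p x1 \<or> \<not> tr m p x1 \<or> \<not> sm m p' x1 \<or> \<not> tr m p' x1"
    if h: "p \<in> Z" "p' \<in> Z" "p \<noteq> p'" "\<not> sm m p p'" "x1 \<in> Z" for p p' x1
  proof (rule ccontr)
    assume "\<not> ?thesis"
    then have w: "x1 \<noteq> p" "x1 \<noteq> p'" "sm m p x1" "sm m p' x1" by auto
    have "sm p p' x1" using all_sameD[OF Z(2)] h w by auto
    then show False using same_fourth[of x1 m p p'] w h Z by (auto simp: c)
  qed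
  show "\<exists>x1 x2 u. x1 \<in> Z \<and> x2 \<in> Z \<and> u \<in> Z \<and> x1 \<noteq> x2 \<and> x2 \<noteq> u \<and> \<not> tr m x1 x2 \<and> \<not> sm m x2 u"
  proof -
    obtain x1 x2 where r: "x1 \<in> Z" "x2 \<in> Z" "x1 \<noteq> x2" "\<not> tr m x1 x2" using A by blast
    obtain s t w where "{s, t, w} \<subseteq> insert m Z" "distinct [s, t, w]" "\<not> sm s t w"
      using n by (auto simp: all_same_def)
    then obtain p p' where p: "p \<in> Z" "p' \<in> Z" "p \<noteq> p'" "\<not> sm m p p'"
      using Z(2) Z(3) all_sameD[of Z s t w] by (auto simp: c)
    from B[OF p r(1)] consider "x1 = p" | "x1 = p'" | "x1 \<noteq> p" "x1 \<noteq> p'" "\<not> sm m p x1" | "x1 \<noteq> p" "x1 \<noteq> p'" "\<not> tr m p x1"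
      | "x1 \<noteq> p" "x1 \<noteq> p'" "\<not> sm m p' x1" | "x1 \<noteq> p" "x1 \<noteq> p'" "\<not> tr m p' x1" by blast
    then show ?thesis
    proof cases
      case 1 show ?thesis by (intro exI[of _ x2] exI[of _ x1] exI[of _ p']) (use r p 1 in \<open>auto simp: c\<close>)
    next
      case 2 show ?thesis by (intro exI[of _ x2] exI[of _ x1] exI[of _ p]) (use r p 2 in \<open>auto simp: c\<close>)
    next
      case 3 show ?thesis by (intro exI[of _ x2] exI[of _ x1] exI[of _ p]) (use r p 3 in \<open>auto simp: c\<close>)
    next
      case 4 show ?thesis by (intro exI[of _ x1] exI[of _ p] exI[of _ p']) (use r p 4 in \<open>auto simp: c\<close>)
    next
      case 5 show ?thesis by (intro exI[of _ x2] exI[of _ x1] exI[of _ p']) (use r p 5 in \<open>auto simp: c\<close>)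
    next
      case 6 show ?thesis by (intro exI[of _ x1] exI[of _ p'] exI[of _ p]) (use r p 6 in \<open>auto simp: c\<close>)
    qed
  qed
qed

lemma all_same_insert:
  assumes "Z \<subseteq> V" "all_same Z" "m \<in> V - Z" "unbalanced_in a Z" "\<not> (\<exists>K. cutset a (insert m Z) K)"
  shows "all_same (insert m Z)"
  using link_exists(2)[OF assms(1-4)] cutset_of_link[OF assms(1-3)] assms(5) by blast

end

text \<open>For \<open>m\<close> outside \<open>Q\<close>: the pair \<open>{m, q}\<close> is a cut of \<open>Q \<union> {m}\<close>.\<close>

definition twin :: "('v \<Rightarrow> 'v \<Rightarrow> 'a::field) \<Rightarrow> 'v set \<Rightarrow> 'v \<Rightarrow> 'v \<Rightarrow> bool" where
  "twin f Q m q \<longleftrightarrow> q \<in> Q \<and> (\<forall>x\<in>Q - {q}. \<forall>x'\<in>Q - {q}. cut4 f m q x x')"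

lemma twinD:
  "twin f Q m q \<Longrightarrow> q \<in> Q"
  "\<lbrakk>twin f Q m q; x \<in> Q; x' \<in> Q; x \<noteq> q; x' \<noteq> q\<rbrakk> \<Longrightarrow> cut4 f m q x x'"
  by (auto simp: twin_def)

text \<open>If the side of \<open>m\<close> contained two elements of \<open>Q\<close>, removing
  \<open>m\<close> would leave a cut of \<open>Q\<close>.\<close>

lemma twin_of_cutset:
  assumes K: "cutset f (insert m Q) K" "m \<in> K" and Q: "m \<notin> Q" "\<not> (\<exists>X. cutset f Q X)"
  shows "\<exists>q. K = {m, q} \<and> twin f Q m q"
proof -
  have KQ: "K - {m} \<subseteq> Q" "insert m Q - K = Q - K" "Q - (K - {m}) = Q - K"
    using K Q by (auto simp: cutset_def)
  have c: "\<And>x x' y y'. \<lbrakk>x \<in> K; x' \<in> K; y \<in> Q - K; y' \<in> Q - K\<rbrakk> \<Longrightarrow> cut4 f x x' y y'"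
    and ys: "\<exists>y\<in>Q - K. \<exists>y'\<in>Q - K. y \<noteq> y'" and xs: "\<exists>x\<in>K. \<exists>x'\<in>K. x \<noteq> x'"
    using K(1) unfolding cutset_def KQ by auto
  obtain q where q: "q \<in> K" "q \<noteq> m" using xs by metis
  have "x = q" if "x \<in> K" "x \<noteq> m" for x
  proof (rule ccontr)
    assume "x \<noteq> q"
    then have "cutset f Q (K - {m})" unfolding cutset_def KQ(3) using KQ(1) c ys q that by blast
    then show False using Q by blast
  qed
  then have Kq: "K = {m, q}" using q K(2) by blast
  then have "Q - K = Q - {q}" using Q by auto
  then have "twin f Q m q" using c Kq q KQ by (auto simp: twin_def)
  then show ?thesis using Kq by blast
qed

lemma cutset_of_cut4:
  "\<lbrakk>distinct [i, j, k, l]; cut4 f i j k l\<rbrakk> \<Longrightarrow> cutset f {i, j, k, l} {i, j}"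
proof -
  assume d: "distinct [i, j, k, l]" and c: "cut4 f i j k l"
  have "{i, j, k, l} - {i, j} = {k, l}" using d by auto
  then show ?thesis using d c unfolding cutset_def by (auto simp: cut4_commute)
qed

text \<open>Transitivity through \<open>m\<close> makes \<open>{q, q'}\<close> a cut of
  \<open>Q\<close>; the cardinality bound supplies two elements on the other side.\<close>

lemma (in rank_one_extending) twin_unique:
  assumes Q: "Q \<subseteq> V" "4 \<le> card Q" "\<not> (\<exists>X. cutset a Q X)" "m \<in> V - Q"
    and t: "twin a Q m q" "twin a Q m q'"
  shows "q = q'"
proof (rule ccontr)
  assume ne: "q \<noteq> q'"
  have "card (Q - {q, q'}) \<ge> 2" using Q(2) ne card_Diff_subset[of "{q, q'}" Q] twinD(1)[OF t(1)] twinD(1)[OF t(2)] by auto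
  then obtain y y' where y: "y \<in> Q - {q, q'}" "y' \<in> Q - {q, q'}" "y \<noteq> y'"
    by (metis card_2_iff' card_le_Suc0_iff_eq card.infinite not_less_eq_eq numeral_2_eq_2 not_numeral_le_zero)
  have "cut4 a q q' z z'" if "z \<in> Q - {q, q'}" "z' \<in> Q - {q, q'}" for z z'
    by (rule cut4_trans[of q m])
      (use that twinD(2)[OF t(1), of z z'] twinD(2)[OF t(2), of z z'] Q in \<open>auto simp: cut4_commute\<close>)
  then have c: "cut4 a x x' z z'" if "x \<in> {q, q'}" "x' \<in> {q, q'}" "z \<in> Q - {q, q'}" "z' \<in> Q - {q, q'}" for x x' z z'
    using that cut4_commute(1)[of a q' q z z'] by auto
  have "cutset a Q {q, q'}"
    unfolding cutset_def using c y ne twinD(1)[OF t(1)] twinD(1)[OF t(2)] by blast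
  then show False using Q by blast
qed

section \<open>Growing an uncut set of one kind by two twins\<close>

context minors4
begin

text \<open>The strictly turned pairs in the link of \<open>m\<close> form the star at
  \<open>q\<close>. A turned pair meeting a strictly same pair gives a cut containing
  \<open>m\<close> and its far end, which is \<open>q\<close> by uniqueness of twins
  (\<open>F1\<close>). The third part of \<open>link_exists\<close> extends this to all turned pairs
  (\<open>F2\<close>).\<close>

lemma link_of_twin:
  assumes Q: "Q \<subseteq> V" "4 \<le> card Q" "\<not> (\<exists>X. cutset a Q X)" "all_same Q" "unbalanced_in a Q"
    and m: "m \<in> V - Q" "twin a Q m q" "\<not> all_same (insert m Q)"
  shows "\<And>x. \<lbrakk>x \<in> Q; x \<noteq> q\<rbrakk> \<Longrightarrow> \<not> sm m q x"
    and "\<And>x x'. \<lbrakk>x \<in> Q; x \<noteq> q; x' \<in> Q; x' \<noteq> q; x \<noteq> x'\<rbrakk> \<Longrightarrow> sm m x x'"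
proof -
  note c = same_commute turned_commute
  have F1: "u = q" if h: "x1 \<in> Q" "x2 \<in> Q" "u \<in> Q" "x1 \<noteq> x2" "x2 \<noteq> u" "\<not> tr m x1 x2" "\<not> sm m x2 u" for x1 x2 u
  proof -
    obtain K where K: "cutset a (insert m Q) K" "m \<in> K" "u \<in> K"
      using cutset_of_link[OF Q(1) Q(4) m(1) h] by blast
    obtain p where "K = {m, p}" "twin a Q m p" using twin_of_cutset[OF K(1,2)] m Q by auto
    then show "u = q" using twin_unique[OF Q(1-3) m(1,2)] K h m by auto
  qed
  obtain x1 x2 where r: "x1 \<in> Q" "x2 \<in> Q" "x1 \<noteq> x2" "\<not> tr m x1 x2"
    using link_exists(1)[OF Q(1,4) m(1) Q(5) m(3)] by blast
  have F2: "p = q \<or> p' = q" if p: "p \<in> Q" "p' \<in> Q" "p \<noteq> p'" "\<not> sm m p p'" for p p'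
  proof -
    have r': "\<not> tr m x2 x1" and p'': "\<not> sm m p' p" using r p by (simp_all add: c)
    from link_exists(3)[OF Q(1,4) m(1) Q(5) m(3) p r(1)]
    consider "x1 = p" | "x1 = p'" | "x1 \<noteq> p" "x1 \<noteq> p'" "\<not> sm m x1 p" | "x1 \<noteq> p" "x1 \<noteq> p'" "\<not> tr m x1 p"
      | "x1 \<noteq> p" "x1 \<noteq> p'" "\<not> sm m x1 p'" | "x1 \<noteq> p" "x1 \<noteq> p'" "\<not> tr m x1 p'"
      by (auto simp: c)
    then show ?thesis
    proof cases
      case 1 then show ?thesis using F1[of x2 p p'] r r' p by auto
    next
      case 2 then show ?thesis using F1[of x2 p' p] r r' p p'' by auto
    next
      case 3 then show ?thesis using F1[of x2 x1 p] r r' p by auto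
    next
      case 4 then show ?thesis using F1[of x1 p p'] r r' p by auto
    next
      case 5 then show ?thesis using F1[of x2 x1 p'] r r' p by auto
    next
      case 6 then show ?thesis using F1[of x1 p' p] r r' p p'' by auto
    qed
  qed
  obtain s t w where "{s, t, w} \<subseteq> insert m Q" "distinct [s, t, w]" "\<not> sm s t w"
    using m(3) by (auto simp: all_same_def)
  then obtain p p' where p: "p \<in> Q" "p' \<in> Q" "p \<noteq> p'" "\<not> sm m p p'"
    using Q(4) m(1) all_sameD[of Q s t w] by (auto simp: c)
  have "\<exists>x0. x0 \<in> Q \<and> x0 \<noteq> q \<and> \<not> sm m q x0"
  proof (cases "p = q")
    case True then show ?thesis using p by auto
  next
    case False then show ?thesis using F2[OF p] p by (intro exI[of _ p]) (auto simp: c)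
  qed
  then obtain x0 where x0: "x0 \<in> Q" "x0 \<noteq> q" "\<not> sm m q x0" by blast
  have qQ: "q \<in> Q" using twinD(1)[OF m(2)] .
  show "\<not> sm m q x" if x: "x \<in> Q" "x \<noteq> q" for x
  proof
    assume s: "sm m q x"
    then have ne: "x \<noteq> x0" using x0 by auto
    have d: "distinct [m, q, x, x0]" "{m, q, x, x0} \<subseteq> V" using ne x x0 qQ m Q by auto
    \<comment> \<open>The cut \<open>{m, q}\<close> against \<open>{x, x0}\<close> carries imbalance
      from \<open>x0\<close> to \<open>x\<close>. So \<open>{x, q}\<close> would be strictly same
      and meet the turned pair \<open>{q, x0}\<close>, and \<open>F1\<close> would give
      \<open>x0 = q\<close>.\<close>
    have "\<not> balanced a m q x0" using balanced_same_turned[of m q x0] x0 d by auto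
    then have "\<not> balanced a m q x" using cut4_balanced[OF d] twinD(2)[OF m(2)] x x0 by auto
    then have "\<not> tr m x q" using balanced_same_turned[of m q x] s d by (auto simp: c)
    then show False using F1[of x q x0] x x0 qQ by auto
  qed
  show "sm m x x'" if "x \<in> Q" "x \<noteq> q" "x' \<in> Q" "x' \<noteq> q" "x \<noteq> x'" for x x'
    using F2[of x x'] that by auto
qed

text \<open>Let \<open>X\<close> be a nontrivial component of the graph on \<open>Q - {q}\<close>
  whose edges form unbalanced triples with \<open>q\<close>; \<open>bal\<close> keeps
  \<open>q'\<close> out of it. By \<open>cut\<close> and transitivity \<open>q'\<close> lies in the
  column class of \<open>q\<close>, and the remaining indices outside \<open>X\<close> are balanced
  with \<open>q\<close> and \<open>X\<close>.\<close>

lemma cutset_of_balanced_pair: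
  assumes Q: "Q \<subseteq> V" "all_same Q" "unbalanced_in a Q"
    and q: "q \<in> Q" "q' \<in> Q" "q \<noteq> q'"
    and bal: "\<And>x. \<lbrakk>x \<in> Q; x \<noteq> q; x \<noteq> q'\<rbrakk> \<Longrightarrow> balanced a q q' x"
    and cut: "\<And>x x'. \<lbrakk>x \<in> Q; x' \<in> Q; x \<noteq> q; x' \<noteq> q; x \<noteq> q'; x' \<noteq> q'; x \<noteq> x'; \<not> balanced a q x x'\<rbrakk>
      \<Longrightarrow> cut4 a x x' q q'"
  shows "\<exists>X. cutset a Q X"
proof -
  have "\<exists>x x'. x \<in> Q \<and> x' \<in> Q \<and> x \<noteq> q \<and> x' \<noteq> q \<and> x \<noteq> x' \<and> \<not> balanced a q x x'"
  proof (rule ccontr)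
    assume no: "\<not> ?thesis"
    obtain x y z where xyz: "{x, y, z} \<subseteq> Q" "distinct [x, y, z]" "\<not> balanced a x y z"
      using Q(3) by (auto simp: unbalanced_in_def)
    have t: "tr q x x'" if "x \<in> Q" "x' \<in> Q" "x \<noteq> q" "x' \<noteq> q" "x \<noteq> x'" for x x'
      using no that balanced_same_turned[of q x x'] q Q by auto
    have "tr x y z"
    proof (cases "q \<in> {x, y, z}")
      case True
      then show ?thesis using t[of x y] t[of y z] t[of x z] xyz by (auto simp: turned_commute)
    next
      case False
      then show ?thesis using t[of x y] t[of y z] t[of x z] turned_fourth[of q x y z] xyz q Q by auto
    qed
    moreover have "sm x y z" using all_sameD[OF Q(2)] xyz by auto
    ultimately show False using xyz balanced_same_turned[of x y z] Q by auto
  qed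
  then obtain x0 x1 where x01: "x0 \<in> Q" "x1 \<in> Q" "x0 \<noteq> q" "x1 \<noteq> q" "x0 \<noteq> x1" "\<not> balanced a q x0 x1" by blast
  have nq': "x \<noteq> q' \<and> x' \<noteq> q'"
    if "x \<in> Q" "x' \<in> Q" "x \<noteq> q" "x' \<noteq> q" "x \<noteq> x'" "\<not> balanced a q x x'" for x x'
    using that bal[of x] bal[of x'] by (auto simp: balanced_commute)
  define E where "E = {(x, x'). x \<in> Q \<and> x' \<in> Q \<and> x \<noteq> q \<and> x' \<noteq> q \<and> x \<noteq> x' \<and> \<not> balanced a q x x'}"
  define X where "X = {x. (x0, x) \<in> E\<^sup>*}"
  have XQ: "x \<in> Q - {q, q'} \<and> cut4 a x0 x q q'" if "(x0, x) \<in> E\<^sup>*" for x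
    using that
  proof (induction rule: rtrancl_induct)
    case base
    then show ?case using x01 nq'[of x0 x1] by auto
  next
    case (step y z)
    have e: "y \<in> Q" "z \<in> Q" "y \<noteq> q" "z \<noteq> q" "y \<noteq> z" "\<not> balanced a q y z"
      using step.hyps by (auto simp: E_def)
    note n = nq'[OF e]
    have "cut4 a y z q q'" using cut[of y z] e n by auto
    then have "cut4 a x0 z q q'"
      using cut4_trans[of x0 y q q' z] step.IH e n q Q by auto
    then show ?case using e n by auto
  qed
  have XX: "X \<subseteq> Q" "q \<notin> X" "q' \<notin> X" using XQ by (auto simp: X_def)
  have cX: "cut4 a x x' q q'" if "x \<in> X" "x' \<in> X" for x x'
    using cut4_trans[of x x0 q q' x'] XQ[of x] XQ[of x'] XQ[of x0] that q Q x01
    by (auto simp: X_def cut4_commute)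
  have x0X: "x0 \<in> X" by (simp add: X_def)
  have x1X: "x1 \<in> X" using x01 by (auto simp: X_def E_def)
  have iff: "(\<forall>x\<in>X. \<forall>x'\<in>X. par a x x' q v) \<longleftrightarrow> (\<forall>x\<in>X. \<forall>x'\<in>X. par a q v x x')"
    if v: "v \<in> Q - X" for v
  proof (cases "v = q")
    case False
    have w: "balanced a x q v" if "x \<in> X" for x
    proof (rule ccontr)
      assume "\<not> balanced a x q v"
      then have "(x, v) \<in> E" using that XX v False by (auto simp: E_def balanced_commute)
      then have "v \<in> X" using that unfolding X_def by (auto intro: rtrancl_into_rtrancl)
      then show False using v by simp
    qed
    have "par a x x' q v \<longleftrightarrow> par a q v x x'" if x: "x \<in> X" "x' \<in> X" for x x'
    proof (cases "x = x'")
      case F: False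
      have d: "distinct [x, x', q, v]" "{x, x', q, v} \<subseteq> V" using F False x v XX q Q by auto
      show ?thesis using par_flip_iff[OF d] balanced_two[OF d] w x by auto
    qed simp
    then show ?thesis by blast
  qed simp
  have "\<exists>K. cutset a Q K \<and> q \<in> K \<and> q' \<in> K \<and> K \<inter> X = {}"
    by (rule cutset_columns[OF _ _ _ _ _ x0X x1X]) (use XX Q q x01 cX iff in auto)
  then show ?thesis by blast
qed

text \<open>If some \<open>{q, q', x}\<close> is unbalanced, the known kinds force the splits of the
  4-sets \<open>{m, q, x, v}\<close>, \<open>{m, q', x, v}\<close> and \<open>{m, q, q', v}\<close>,
  which contradict \<open>p\<close>. Otherwise every \<open>{m, x, v}\<close> is strictly turned,
  and the splits of \<open>{m, v, x, x'}\<close> supply the cuts needed for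
  \<open>cutset_of_balanced_pair\<close>.\<close>

lemma two_twins_coherent:
  assumes Q: "Q \<subseteq> V" "\<not> (\<exists>X. cutset a Q X)" "all_same Q" "unbalanced_in a Q"
    and mv: "m \<in> V - Q" "v \<in> V - Q" "m \<noteq> v"
    and t: "twin a Q m q" "twin a Q v q'" "q \<noteq> q'"
    and p: "\<And>x. \<lbrakk>x \<in> Q; x \<noteq> q\<rbrakk> \<Longrightarrow> par a q m x v" "\<And>x. \<lbrakk>x \<in> Q; x \<noteq> q\<rbrakk> \<Longrightarrow> \<not> par a x v q m"
    and bm: "\<And>x. \<lbrakk>x \<in> Q; x \<noteq> q\<rbrakk> \<Longrightarrow> \<not> sm m q x"
    and sm: "\<And>x x'. \<lbrakk>x \<in> Q; x \<noteq> q; x' \<in> Q; x' \<noteq> q; x \<noteq> x'\<rbrakk> \<Longrightarrow> sm m x x'"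
    and bv: "\<And>x. \<lbrakk>x \<in> Q; x \<noteq> q'\<rbrakk> \<Longrightarrow> \<not> sm v q' x"
    and sv: "\<And>x x'. \<lbrakk>x \<in> Q; x \<noteq> q'; x' \<in> Q; x' \<noteq> q'; x \<noteq> x'\<rbrakk> \<Longrightarrow> sm v x x'"
  shows False
proof -
  note c = same_commute turned_commute
  have qQ: "q \<in> Q" "q' \<in> Q" using twinD(1)[OF t(1)] twinD(1)[OF t(2)] .
  have bxv: "balanced a q x v \<longleftrightarrow> balanced a q q' x" if x: "x \<in> Q" "x \<noteq> q" "x \<noteq> q'" for x
  proof -
    have "cut4 a q x v q'" using twinD(2)[OF t(2), of q x] x qQ t by (simp add: cut4_flip[of a q x])
    then show ?thesis using cut4_balanced[of q x v q'] x qQ mv Q t by (auto simp: balanced_commute)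
  qed
  have bmx: "balanced a m q' x \<longleftrightarrow> balanced a q q' x" if x: "x \<in> Q" "x \<noteq> q" "x \<noteq> q'" for x
  proof -
    have "cut4 a q' x m q" using twinD(2)[OF t(1), of q' x] x qQ t by (simp add: cut4_flip[of a q' x])
    then show ?thesis using cut4_balanced[of q' x m q] x qQ mv Q t by (auto simp: balanced_commute)
  qed
  show False
  proof (cases "\<exists>x\<in>Q - {q, q'}. \<not> balanced a q q' x")
    case True
    then obtain x where x: "x \<in> Q" "x \<noteq> q" "x \<noteq> q'" "\<not> balanced a q q' x" by blast
    have d1: "distinct [m, q, x, v]" "{m, q, x, v} \<subseteq> V" and d2: "distinct [m, q', x, v]" "{m, q', x, v} \<subseteq> V"
      and d3: "distinct [m, q, q', v]" "{m, q, q', v} \<subseteq> V"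
      using x qQ mv t Q by auto
    have sqxv: "sm q x v" using sv[of q x] x qQ t by (simp add: c)
    then have rqxv: "\<not> tr q x v" using bxv[of x] x balanced_same_turned[of q x v] d1 by auto
    have bmqx: "\<not> sm m q x" "tr m q x" using bm[of x] x same_or_turned[of m q x] d1 by auto
    have ncut: "\<not> cut4 a m q x v" using p(2)[of x] x by (auto simp: cut4_def par_commute)
    from fourset[OF d1] have 1: "cut4 a m x q v" "\<not> tr m q v"
      unfolding mixed_def using sqxv rqxv bmqx ncut by (auto simp: c)
    have sm1: "sm m q' x" using sm[of q' x] x qQ t by (simp add: c)
    then have rm: "\<not> tr m q' x" using bmx[of x] x balanced_same_turned[of m q' x] d2 by auto
    have "\<not> sm v q' x" using bv[of x] x by auto
    then have bq: "\<not> sm q' x v" "tr q' x v" using same_or_turned[of q' x v] d2 by (auto simp: c)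
    have pq: "par a q' v q x"
      using twinD(2)[OF t(2), of q x] x qQ t by (auto simp: cut4_def par_commute)
    have npq: "\<not> par a q' v q m" using p(2)[of q'] qQ t by auto
    have "\<not> par a q' v m x"
      using par_trans_col[of q' v q x m] pq npq d1 d2 by (auto simp: par_commute)
    then have ncut2: "\<not> cut4 a m x q' v" by (auto simp: cut4_def)
    from fourset[OF d2] have 2: "cut4 a m q' x v" "\<not> tr m q' v"
      unfolding mixed_def using sm1 rm bq ncut2 by (auto simp: c)
    have b3: "\<not> sm m q q'" using bm[of q'] qQ t by auto
    have b4: "\<not> sm q q' v" using bv[of q] qQ t by (auto simp: c)
    from fourset[OF d3] have 3: "cut4 a m v q q'"
      unfolding mixed_def using b3 b4 1 2 same_or_turned[of m q q'] same_or_turned[of q q' v] d3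
      by (auto simp: c)
    \<comment> \<open>Rows \<open>q'\<close>, \<open>q\<close> and rows \<open>q\<close>,
      \<open>v\<close> will both be parallel on \<open>m\<close>, \<open>x\<close>, hence also rows
      \<open>q'\<close>, \<open>v\<close>, which was excluded above.\<close>
    have "par a q q' x v"
      using par_trans_row[of q m x v q'] p(1)[of x] 2(1) x d1 by (auto simp: cut4_def)
    moreover have "par a q q' v m" using 3 by (auto simp: cut4_def par_commute)
    ultimately have "par a q' q m x"
      using par_trans_col[of q q' x v m] d3 by (auto simp: par_commute)
    moreover have "par a q v m x" using 1 by (auto simp: cut4_def)
    ultimately have "par a q' v m x" using par_trans_row[of q' q m x v] d1 by auto
    then show False using \<open>\<not> par a q' v m x\<close> by simp
  next
    case False
    then have bal: "balanced a q q' x" if "x \<in> Q" "x \<noteq> q" "x \<noteq> q'" for x using that by auto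
    have bmxv: "\<not> sm m x v" if x: "x \<in> Q" "x \<noteq> q" "x \<noteq> q'" for x
    proof -
      have d: "distinct [m, q, x, v]" "{m, q, x, v} \<subseteq> V" using x qQ mv Q by auto
      have b: "balanced a q x v" using bxv[OF x] bal[OF x] by simp
      then have st: "sm q x v" "tr q x v" using balanced_same_turned[of q x v] d by auto
      have bmqx: "\<not> sm m q x" using bm x by auto
      \<comment> \<open>A mixed 4-set has no balanced triple, so \<open>{m, q, x, v}\<close> has a
        single kind, which \<open>{m, q, x}\<close> determines.\<close>
      from fourset[OF d] have "tr m x v" unfolding mixed_def using st bmqx by (auto simp: c)
      moreover have "\<not> balanced a m x v"
      proof
        assume "balanced a m x v"
        then have "tratio a m q x = tratio a m q v"
          using tratio_cocycle[OF d] b d by (simp add: balanced_iff)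
        then show False using par_iff_tratio[OF d] p[of x] x by (auto simp: par_commute)
      qed
      ultimately show ?thesis using balanced_same_turned[of m x v] d by auto
    qed
    have "\<exists>X. cutset a Q X"
    proof (rule cutset_of_balanced_pair[OF Q(1,3,4) qQ t(3) bal])
      fix x x' assume x: "x \<in> Q" "x' \<in> Q" "x \<noteq> q" "x' \<noteq> q" "x \<noteq> q'" "x' \<noteq> q'" "x \<noteq> x'"
        "\<not> balanced a q x x'"
      have d: "distinct [m, v, x, x']" "{m, v, x, x'} \<subseteq> V" using x mv Q by auto
      have cm: "cut4 a m q x x'" using twinD(2)[OF t(1)] x by auto
      have cv: "cut4 a v q' x x'" using twinD(2)[OF t(2)] x by auto
      have "\<not> balanced a m x x'"
        using cut4_balanced[of x x' m q] cm x mv qQ Q by (auto simp: cut4_flip[of a x x'] balanced_commute)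
      then have r: "\<not> tr m x x'" "sm m x x'"
        using sm[of x x'] balanced_same_turned[of m x x'] x d by auto
      have b: "\<not> sm m x v" "\<not> sm m x' v" using bmxv x by auto
      then have "tr m x v" "tr m x' v"
        using same_or_turned[of m x v] same_or_turned[of m x' v] d by auto
      from fourset[OF d] have cmv: "cut4 a m v x x'"
        unfolding mixed_def using r b \<open>tr m x v\<close> \<open>tr m x' v\<close> by (auto simp: c)
      have "cut4 a q v x x'"
        using cut4_trans[of q m x x' v] cm cmv d by (auto simp: cut4_commute)
      then have "cut4 a q q' x x'" using cut4_trans[of q v x x' q'] cv d by auto
      then show "cut4 a x x' q q'" by (simp add: cut4_flip[of a x x'])
    qed
    then show False using Q by blast
  qed
qed

text \<open>Since \<open>m\<close> is a twin of \<open>q\<close>, the asymmetry at \<open>y\<close>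
  spreads over \<open>Q - {q}\<close>. A cut of \<open>Z\<close> restricts to \<open>Q\<close>
  unless one side meets \<open>Q\<close> in at most one element; such sides contradict uniqueness of
  twins or the asymmetry. If \<open>Z\<close> were not all same, neither one-point extension would
  be, and \<open>two_twins_coherent\<close> applies.\<close>

lemma grow_two:
  assumes Q: "Q \<subseteq> V" "4 \<le> card Q" "\<not> (\<exists>X. cutset a Q X)" "all_same Q" "unbalanced_in a Q"
    and mv: "m \<in> V - Q" "v \<in> V - Q" and t: "twin a Q m q" "twin a Q v q'" "q \<noteq> q'"
    and y: "y \<in> Q" "y \<noteq> q" "par a q m y v" "\<not> par a y v q m"
  shows "\<exists>Q'. Q \<subset> Q' \<and> Q' \<subseteq> V \<and> \<not> (\<exists>X. cutset a Q' X) \<and> all_same Q'"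
proof -
  have qQ: "q \<in> Q" "q' \<in> Q" using twinD(1)[OF t(1)] twinD(1)[OF t(2)] .
  have um: "p = q" if "twin a Q m p" for p using twin_unique[OF Q(1-3) mv(1) that t(1)] .
  have uv: "p = q'" if "twin a Q v p" for p using twin_unique[OF Q(1-3) mv(2) that t(2)] .
  have ne: "m \<noteq> v" using um t by blast
  have p1: "par a q m x v" if x: "x \<in> Q" "x \<noteq> q" for x
  proof (rule par_trans_col[of q m x y])
    show "par a q m x y" using twinD(2)[OF t(1), of x y] x y by (auto simp: cut4_def par_commute)
  qed (use y qQ mv Q in auto)
  have p2: "\<not> par a x v q m" if x: "x \<in> Q" "x \<noteq> q" for x
  proof
    assume "par a x v q m"
    moreover have "par a y x q m" using twinD(2)[OF t(1), of y x] x y by (auto simp: cut4_def par_commute)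
    ultimately have "par a y v q m" using par_trans_row[of y x q m v] x qQ mv Q by auto
    then show False using y by simp
  qed
  define Z where "Z = insert v (insert m Q)"
  have noZ: "\<not> (\<exists>X. cutset a Z X)"
  proof
    assume "\<exists>X. cutset a Z X"
    then obtain X0 where X0: "cutset a Z X0" by blast
    have small: False if X: "cutset a Z X" and s: "\<And>x x'. \<lbrakk>x \<in> X \<inter> Q; x' \<in> X \<inter> Q\<rbrakk> \<Longrightarrow> x = x'" for X
    proof -
      have XZ: "X \<subseteq> insert v (insert m Q)"
        and cX: "\<And>x x' y y'. \<lbrakk>x \<in> X; x' \<in> X; y \<in> Z - X; y' \<in> Z - X\<rbrakk> \<Longrightarrow> cut4 a x x' y y'"
        and two: "\<exists>x\<in>X. \<exists>x'\<in>X. x \<noteq> x'"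
        using X by (auto simp: cutset_def Z_def)
      have tw: "twin a Q z p" if z: "z \<in> X" and p: "p \<in> X" "p \<in> Q" for z p
        unfolding twin_def
      proof (intro conjI ballI)
        fix x x' assume "x \<in> Q - {p}" "x' \<in> Q - {p}"
        then have "x \<in> Z - X" "x' \<in> Z - X" using s[of x p] s[of x' p] p by (auto simp: Z_def)
        then show "cut4 a z p x x'" using cX z p by blast
      qed (rule p(2))
      consider (no) "X \<inter> Q = {}" | (one) p where "p \<in> X" "p \<in> Q" by blast
      then show False
      proof cases
        case no
        then have X: "m \<in> X" "v \<in> X" using two XZ by auto
        have "twin a Q v q" unfolding twin_def
        proof (intro conjI ballI)
          fix x x' assume x: "x \<in> Q - {q}" "x' \<in> Q - {q}"
          have "cut4 a v m x x'" using cX[of v m x x'] X x no by (auto simp: Z_def)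
          then show "cut4 a v q x x'"
            using cut4_trans[of v m x x' q] twinD(2)[OF t(1), of x x'] x mv Q by auto
        qed (rule qQ)
        then show False using uv t by blast
      next
        case one
        have Xp: "X \<subseteq> {p, m, v}" using XZ s[OF _ IntI[OF one]] by blast
        consider "m \<in> X" "v \<in> X" | "m \<in> X" "v \<notin> X" | "m \<notin> X" "v \<in> X" using two Xp by blast
        then show False
        proof cases
          case 1
          then show False using um[OF tw[of m p]] uv[OF tw[of v p]] one t by simp
        next
          case 2
          then have pq: "p = q" using um tw one by blast
          have "q' \<in> Z - X" "v \<in> Z - X" using Xp 2 pq t qQ mv by (auto simp: Z_def)
          then have "cut4 a q m q' v" using cX[of q m q' v] 2 one pq by blast
          then show False using p2[of q'] qQ t by (auto simp: cut4_def)
        next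
          case 3
          then have pq: "p = q'" using uv tw one by blast
          have "q \<in> Z - X" "m \<in> Z - X" using Xp 3 pq t qQ mv by (auto simp: Z_def)
          then have "cut4 a q' v q m" using cX[of q' v q m] 3 one pq by blast
          then show False using p2[of q'] qQ t by (auto simp: cut4_def)
        qed
      qed
    qed
    have X0': "cutset a Z (Z - X0)" by (rule cutset_compl[OF X0])
    have "\<exists>x\<in>X0 \<inter> Q. \<exists>x'\<in>X0 \<inter> Q. x \<noteq> x'" using small[OF X0] by blast
    moreover have "\<exists>x\<in>Q - X0. \<exists>x'\<in>Q - X0. x \<noteq> x'" using small[OF X0'] by (auto simp: Z_def)
    moreover have "\<And>x x' y y'. \<lbrakk>x \<in> X0 \<inter> Q; x' \<in> X0 \<inter> Q; y \<in> Q - X0; y' \<in> Q - X0\<rbrakk> \<Longrightarrow> cut4 a x x' y y'"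
      using X0 by (auto simp: cutset_def Z_def)
    moreover have "Q - X0 \<inter> Q = Q - X0" by auto
    ultimately have "cutset a Q (X0 \<inter> Q)" unfolding cutset_def by auto
    then show False using Q by blast
  qed
  have ZV: "Q \<subset> Z" "Z \<subseteq> V" using mv Q by (auto simp: Z_def)
  have ub: "unbalanced_in a (insert z Q)" for z using unbalanced_in_mono[OF Q(5)] by blast
  have "all_same Z"
  proof (rule ccontr)
    assume n: "\<not> all_same Z"
    have nm: "\<not> all_same (insert m Q)"
    proof
      assume s: "all_same (insert m Q)"
      have "all_same (insert v (insert m Q))"
        by (rule all_same_insert[OF _ s _ ub]) (use noZ mv Q ne in \<open>auto simp: Z_def\<close>)
      then show False using n by (simp add: Z_def)
    qed
    have nv: "\<not> all_same (insert v Q)"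
    proof
      assume s: "all_same (insert v Q)"
      have "all_same (insert m (insert v Q))"
        by (rule all_same_insert[OF _ s _ ub]) (use noZ mv Q ne in \<open>auto simp: Z_def insert_commute\<close>)
      then show False using n by (simp add: Z_def insert_commute)
    qed
    show False
      by (rule two_twins_coherent[OF Q(1,3,4,5) mv ne t p1 p2 link_of_twin[OF Q mv(1) t(1) nm]
          link_of_twin[OF Q mv(2) t(2) nv]])
  qed
  then show ?thesis using ZV noZ by blast
qed

text \<open>If \<open>Q\<close> cannot grow, every outside index is a twin. Let \<open>X\<close>
  consist of \<open>q\<close> and its twins. As \<open>V\<close> has no cut,
  \<open>cutset_columns\<close> yields \<open>v\<close> on which the matrix and its transpose
  disagree. It is a twin of another \<open>q'\<close>, and transitivity locates the disagreement at
  a pair \<open>{q, m}\<close>, as \<open>grow_two\<close> requires.\<close>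

lemma grow:
  assumes Q: "Q \<subset> V" "4 \<le> card Q" "\<not> (\<exists>X. cutset a Q X)" "all_same Q" "unbalanced_in a Q"
    and noc: "\<not> (\<exists>X. cutset a V X)"
  shows "\<exists>Q'. Q \<subset> Q' \<and> Q' \<subseteq> V \<and> \<not> (\<exists>X. cutset a Q' X) \<and> all_same Q'"
proof (rule ccontr)
  assume no: "\<not> ?thesis"
  have QV: "Q \<subseteq> V" using Q by auto
  have tw: "\<exists>q. twin a Q m q" if m: "m \<in> V - Q" for m
  proof -
    have "\<exists>K. cutset a (insert m Q) K"
    proof (rule ccontr)
      assume n: "\<not> ?thesis"
      have "all_same (insert m Q)" by (rule all_same_insert[OF QV Q(4) m Q(5) n])
      then show False using no n m QV by blast
    qed
    then obtain K where K: "cutset a (insert m Q) K" by blast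
    have "\<exists>K. cutset a (insert m Q) K \<and> m \<in> K"
    proof (cases "m \<in> K")
      case False
      then show ?thesis using cutset_compl[OF K] by blast
    qed (use K in blast)
    then show ?thesis using twin_of_cutset[of a m Q] m Q by blast
  qed
  obtain m0 where m0: "m0 \<in> V - Q" using Q by auto
  obtain q where q: "twin a Q m0 q" using tw[OF m0] by blast
  have qQ: "q \<in> Q" using twinD(1)[OF q] .
  define X where "X = insert q {m \<in> V - Q. twin a Q m q}"
  have "card (Q - {q}) \<ge> 2" using Q(2) qQ by simp
  then obtain y0 y1 where y: "y0 \<in> Q" "y0 \<noteq> q" "y1 \<in> Q" "y1 \<noteq> q" "y0 \<noteq> y1"
    by (metis (no_types, lifting) DiffD1 DiffD2 card_2_iff' card_le_Suc0_iff_eq card.infinite insertI1 not_less_eq_eq numeral_2_eq_2 not_numeral_le_zero)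
  have Xq: "cut4 a x q z z'" if "x \<in> X" "z \<in> Q" "z' \<in> Q" "z \<noteq> q" "z' \<noteq> q" for x z z'
    using that twinD(2)[of a Q x q z z'] by (auto simp: X_def)
  have XX: "cut4 a x x' z z'" if x: "x \<in> X" "x' \<in> X" "z \<in> Q" "z' \<in> Q" "z \<noteq> q" "z' \<noteq> q" for x x' z z'
  proof -
    have "cut4 a x q z z'" "cut4 a q x' z z'" using Xq[of x z z'] Xq[of x' z z'] x by (auto simp: cut4_commute)
    then show ?thesis using cut4_trans[of x q z z' x'] x qQ QV by auto
  qed
  have "\<exists>v\<in>V - X. \<not> ((\<forall>x\<in>X. \<forall>x'\<in>X. par a x x' y0 v) \<longleftrightarrow> (\<forall>x\<in>X. \<forall>x'\<in>X. par a y0 v x x'))"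
  proof (rule ccontr)
    assume n: "\<not> ?thesis"
    have "\<exists>K. cutset a V K \<and> y0 \<in> K \<and> y1 \<in> K \<and> K \<inter> X = {}"
    proof (rule cutset_columns[where ?x0.0 = q and ?x1.0 = m0])
      show "(\<forall>x\<in>X. \<forall>x'\<in>X. par a x x' y0 v) \<longleftrightarrow> (\<forall>x\<in>X. \<forall>x'\<in>X. par a y0 v x x')" if "v \<in> V - X" for v
        using n that by blast
    qed (use XX y QV qQ m0 q in \<open>auto simp: X_def\<close>)
    then show False using noc by blast
  qed
  then obtain v where v: "v \<in> V - X"
    "\<not> ((\<forall>x\<in>X. \<forall>x'\<in>X. par a x x' y0 v) \<longleftrightarrow> (\<forall>x\<in>X. \<forall>x'\<in>X. par a y0 v x x'))" by blast
  have vQ: "v \<notin> Q"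
  proof
    assume vv: "v \<in> Q"
    then have "v \<noteq> q" using v by (auto simp: X_def)
    then have "\<And>x x'. x \<in> X \<Longrightarrow> x' \<in> X \<Longrightarrow> cut4 a x x' y0 v" using XX y vv by auto
    then show False using v by (auto simp: cut4_def)
  qed
  have vq: "v \<noteq> q" "q \<noteq> v" using vQ qQ by auto
  obtain q' where q': "twin a Q v q'" using tw[of v] v vQ by auto
  have qq': "q \<noteq> q'" using v vQ q' by (auto simp: X_def)
  from v(2) consider (out) "\<forall>x\<in>X. \<forall>x'\<in>X. par a x x' y0 v" "\<exists>x\<in>X. \<exists>x'\<in>X. \<not> par a y0 v x x'"
    | (inn) "\<forall>x\<in>X. \<forall>x'\<in>X. par a y0 v x x'" "\<exists>x\<in>X. \<exists>x'\<in>X. \<not> par a x x' y0 v" by blast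
  then show False
  proof cases
    case out
    have "\<exists>m\<in>X. \<not> par a y0 v q m"
    proof (rule ccontr)
      assume "\<not> ?thesis"
      then have h: "\<And>m. m \<in> X \<Longrightarrow> par a y0 v q m" by blast
      have "par a y0 v x x'" if "x \<in> X" "x' \<in> X" for x x'
        using par_trans_col[of y0 v x q x'] h[of x] h[of x'] par_commute(2)[of a y0 v x q] that y v(1) vq qQ QV
        by auto
      then show False using out by blast
    qed
    then obtain m where m: "m \<in> X" "\<not> par a y0 v q m" by blast
    then have "m \<noteq> q" by auto
    then have m': "m \<in> V - Q" "twin a Q m q" using m by (auto simp: X_def)
    have "par a q m y0 v" using out m by (auto simp: X_def)
    then show False using grow_two[OF QV Q(2-5) m'(1) _ m'(2) q' qq' y(1,2) _ m(2)] v vQ no by blast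
  next
    case inn
    \<comment> \<open>The asymmetry now has the opposite direction. Transposing both matrices
      reverses it and preserves cuts, twins and kinds.\<close>
    interpret T: minors4 "flip_args a" V "flip_args b" by (rule flip_both)
    have as: "T.all_same = all_same" by (simp add: T.all_same_def all_same_def same_flip_both fun_eq_iff)
    have ub: "unbalanced_in (flip_args a) = unbalanced_in a"
      by (simp add: unbalanced_in_def balanced_transpose fun_eq_iff)
    have tt: "twin (flip_args a) = twin a" by (simp add: twin_def cut4_transpose fun_eq_iff)
    have "\<exists>m\<in>X. \<not> par a q m y0 v"
    proof (rule ccontr)
      assume "\<not> ?thesis"
      then have h: "\<And>m. m \<in> X \<Longrightarrow> par a q m y0 v" by blast
      have "par a x x' y0 v" if "x \<in> X" "x' \<in> X" for x x'
        using par_trans_row[of x q y0 v x'] h[of x] h[of x'] par_commute(1)[of a x q y0 v] that y v(1) vq qQ QV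
        by auto
      then show False using inn by blast
    qed
    then obtain m where m: "m \<in> X" "\<not> par a q m y0 v" by blast
    then have "m \<noteq> q" by auto
    then have m': "m \<in> V - Q" "twin a Q m q" using m by (auto simp: X_def)
    have "par a y0 v q m" using inn m by (auto simp: X_def)
    then have "\<exists>Q'. Q \<subset> Q' \<and> Q' \<subseteq> V \<and> \<not> (\<exists>X. cutset (flip_args a) Q' X) \<and> T.all_same Q'"
      by (intro T.grow_two[of Q m v q q' y0])
        (use QV Q m' m y v vQ q' qq' in \<open>auto simp: as ub tt cutset_transpose par_transpose\<close>)
    then show False using no by (simp add: as cutset_transpose)
  qed
qed

theorem all_same_or_all_turned:
  assumes noc: "\<not> (\<exists>X. cutset a V X)"
  shows "all_same V \<or> all_turned V"
proof (rule ccontr)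
  assume n: "\<not> ?thesis"
  interpret F: minors4 a V "flip_args b" by (rule flip_b)
  have at: "F.all_same = all_turned"
    by (simp add: F.all_same_def all_turned_def turned_flip fun_eq_iff)
  obtain i j k l where d: "distinct [i, j, k, l]" "{i, j, k, l} \<subseteq> V" and mx: "mixed a b i j k l"
    using mixed_exists n by blast
  have "cut4 a i j k l" "\<not> balanced a i j k"
    using mx balanced_same_turned[of i j k] d by (auto simp: mixed_def)
  from uncut_four_exists[OF noc d this] obtain Q0
    where Q0: "Q0 \<subseteq> V" "card Q0 = 4" "\<not> (\<exists>X. cutset a Q0 X)" "unbalanced_in a Q0" by blast
  \<comment> \<open>Maximality ranges over both kinds at once; turned sets are handled as same sets
    for the transpose of \<open>b\<close>.\<close>
  define G where "G Q \<longleftrightarrow> Q \<subseteq> V \<and> 4 \<le> card Q \<and> \<not> (\<exists>X. cutset a Q X) \<and> unbalanced_in a Q \<and>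
    (all_same Q \<or> all_turned Q)" for Q
  have "G Q0"
  proof -
    obtain w x y z where e: "Q0 = {w, x, y, z}" "distinct [w, x, y, z]"
      using Q0(2) by (auto simp: card_Suc_eq numeral_eq_Suc)
    have "\<not> cut4 a w x y z" using cutset_of_cut4[OF e(2)] Q0(3) e(1) by blast
    moreover have "\<not> cut4 a w y x z"
    proof
      assume h: "cut4 a w y x z"
      have "cutset a {w, y, x, z} {w, y}" by (rule cutset_of_cut4[OF _ h]) (use e in auto)
      then show False using Q0(3) e(1) by (auto simp: insert_commute)
    qed
    moreover have "\<not> cut4 a w z x y"
    proof
      assume h: "cut4 a w z x y"
      have "cutset a {w, z, x, y} {w, z}" by (rule cutset_of_cut4[OF _ h]) (use e in auto)
      then show False using Q0(3) e(1) by (auto simp: insert_commute)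
    qed
    ultimately have "sm w x y \<and> sm w x z \<and> sm w y z \<and> sm x y z \<or> tr w x y \<and> tr w x z \<and> tr w y z \<and> tr x y z"
      using fourset[of w x y z] e Q0(1) by (auto simp: mixed_def)
    then have "all_same Q0 \<or> all_turned Q0"
    proof
      assume s: "sm w x y \<and> sm w x z \<and> sm w y z \<and> sm x y z"
      have "all_same Q0" unfolding all_same_def e(1) using s by (auto simp: same_commute)
      then show ?thesis ..
    next
      assume s: "tr w x y \<and> tr w x z \<and> tr w y z \<and> tr x y z"
      have "all_turned Q0" unfolding all_turned_def e(1) using s by (auto simp: turned_commute)
      then show ?thesis ..
    qed
    then show ?thesis using Q0 by (simp add: G_def)
  qed
  then have "\<exists>Q. G Q \<and> (\<forall>Q'. G Q' \<longrightarrow> card Q' \<le> card Q)"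
    by (rule ex_has_greatest_nat[of _ _ _ "Suc (card V)"])
      (use finV in \<open>auto intro: card_mono simp: G_def less_Suc_eq_le\<close>)
  then obtain Q where Q: "G Q" and max: "\<And>Q'. G Q' \<Longrightarrow> card Q' \<le> card Q" by blast
  have "Q \<noteq> V" using n Q by (auto simp: G_def)
  then have QV: "Q \<subset> V" using Q by (auto simp: G_def)
  have "\<exists>Q'. Q \<subset> Q' \<and> Q' \<subseteq> V \<and> \<not> (\<exists>X. cutset a Q' X) \<and> (all_same Q' \<or> all_turned Q')"
  proof (cases "all_same Q")
    case True
    then show ?thesis using grow[OF QV _ _ True _ noc] Q unfolding G_def by blast
  next
    case False
    then have "F.all_same Q" using Q by (simp add: G_def at)
    then show ?thesis using F.grow[OF QV _ _ _ _ noc] Q unfolding G_def at by blast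
  qed
  then obtain Q' where Q': "Q \<subset> Q'" "Q' \<subseteq> V" "\<not> (\<exists>X. cutset a Q' X)" "all_same Q' \<or> all_turned Q'" by blast
  have fin: "finite Q'" using Q' finV finite_subset by blast
  have lt: "card Q < card Q'" using Q' fin psubset_card_mono by blast
  have "unbalanced_in a Q'" using Q Q'(1) unbalanced_in_mono[of a Q Q'] by (auto simp: G_def)
  then have "G Q'" using Q Q' lt by (auto simp: G_def)
  then show False using max lt by (simp add: leD)
qed

end

section \<open>Submatrices, ranks and small determinants\<close>

lemma pick_sorted:
  assumes s: "sorted_wrt (<) xs" and u: "u < length xs"
  shows "pick (set xs) u = xs ! u"
proof -
  have lt: "xs ! v < xs ! u \<longleftrightarrow> v < u" if "v < length xs" for v
    using sorted_wrt_nth_less[OF s] u that by (metis less_asym linorder_neqE_nat)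
  have "{a \<in> set xs. a < xs ! u} = nth xs ` {0..<u}"
  proof (intro equalityI subsetI)
    fix a assume "a \<in> {a \<in> set xs. a < xs ! u}"
    then obtain v where "v < length xs" "a = xs ! v" "a < xs ! u" by (auto simp: in_set_conv_nth)
    then show "a \<in> nth xs ` {0..<u}" using lt by auto
  next
    fix a assume "a \<in> nth xs ` {0..<u}"
    then show "a \<in> {a \<in> set xs. a < xs ! u}" using lt u by auto
  qed
  then have "{a \<in> set xs. a < xs ! u} = set (take u xs)" using nth_image[of u xs] u by simp
  moreover have "card (set (take u xs)) = u"
    using u strict_sorted_iff[of xs] s by (simp add: distinct_card)
  ultimately show ?thesis
    using pick_card_in_set[of "xs ! u" "set xs"] u by simp
qed

lemma submatrix_sorted:
  assumes xs: "sorted_wrt (<) xs" "set xs \<subseteq> {..<dim_row M}"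
    and ys: "sorted_wrt (<) ys" "set ys \<subseteq> {..<dim_col M}"
  shows "submatrix M (set xs) (set ys) = mat (length xs) (length ys) (\<lambda>(u, v). M $$ (xs ! u, ys ! v))"
proof -
  have "{i. i < dim_row M \<and> i \<in> set xs} = set xs" "{i. i < dim_col M \<and> i \<in> set ys} = set ys"
    using xs ys by auto
  moreover have "card (set xs) = length xs" "card (set ys) = length ys"
    using xs ys strict_sorted_iff distinct_card by blast+
  ultimately show ?thesis
    unfolding submatrix_def by (intro eq_matI) (auto simp: pick_sorted xs ys)
qed

text \<open>Expansion along column 0 leaves minors that are again of the form
  \<open>mat k k\<close>, so rewriting can be repeated down to order zero.\<close>

lemma det_mat_Suc:
  "det (mat (Suc k) (Suc k) f) =
     (\<Sum>i<Suc k. (- 1) ^ i * f (i, 0) * det (mat k k (\<lambda>(r, c). f (if r < i then r else Suc r, Suc c))))"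
proof -
  have "mat_delete (mat (Suc k) (Suc k) f) i 0 = mat k k (\<lambda>(r, c). f (if r < i then r else Suc r, Suc c))"
    if "i < Suc k" for i
    unfolding mat_delete_def by (intro eq_matI) (use that in auto)
  then show ?thesis
    by (subst laplace_expansion_column[of _ "Suc k" 0]) (auto simp: cofactor_def mult_ac intro!: sum.cong)
qed

lemma det_mat_2: "det (mat 2 2 f) = f (0, 0) * f (1, 1) - f (0, 1) * f (1, 0)"
  by (simp add: numeral_eq_Suc det_mat_Suc)

lemma det_mat_3:
  fixes g :: "nat \<Rightarrow> nat \<Rightarrow> 'a::field"
  assumes "f = (\<lambda>(u, v). g ([i, j, k] ! u) ([i, j, k] ! v))"
  shows "det (mat 3 3 f) = g i i * g j j * g k k - g i i * (g j k * g k j) - g j j * (g i k * g k i)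
    - g k k * (g i j * g j i) + (cyc g i j k + cyc g i k j)"
  unfolding assms by (simp add: numeral_eq_Suc det_mat_Suc cyc_def algebra_simps)

text \<open>Grouping by cycle type isolates the 4-cycles in \<open>quad\<close>; all other terms are
  fixed by diagonal entries and by sums and products from smaller minors.\<close>

lemma det_mat_4:
  fixes g :: "nat \<Rightarrow> nat \<Rightarrow> 'a::field"
  assumes "f = (\<lambda>(u, v). g ([i, j, k, l] ! u) ([i, j, k, l] ! v))"
  shows "det (mat 4 4 f) = g i i * g j j * g k k * g l l
    - g i i * g j j * (g k l * g l k) - g i i * g k k * (g j l * g l j) - g i i * g l l * (g j k * g k j)
    - g j j * g k k * (g i l * g l i) - g j j * g l l * (g i k * g k i) - g k k * g l l * (g i j * g j i)
    + (g i j * g j i) * (g k l * g l k) + (g i k * g k i) * (g j l * g l j) + (g i l * g l i) * (g j k * g k j)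
    + g i i * (cyc g j k l + cyc g j l k) + g j j * (cyc g i k l + cyc g i l k)
    + g k k * (cyc g i j l + cyc g i l j) + g l l * (cyc g i j k + cyc g i k j) - quad g i j k l"
  unfolding assms by (simp add: numeral_eq_Suc det_mat_Suc cyc_def quad_def algebra_simps)

section \<open>Determinants under diagonal similarity\<close>

lemma det_diag_similar:
  fixes A B :: "'a::field mat"
  assumes A: "A \<in> carrier_mat k k" and B: "B \<in> carrier_mat k k"
    and d: "\<And>i. i < k \<Longrightarrow> d i \<noteq> 0"
    and AB: "\<And>i j. \<lbrakk>i < k; j < k\<rbrakk> \<Longrightarrow> B $$ (i, j) = d i * A $$ (i, j) / d j"
  shows "det B = det A"
proof -
  have "(\<Prod>i = 0..<k. B $$ (i, p i)) = (\<Prod>i = 0..<k. A $$ (i, p i))" if p: "p permutes {0..<k}" for p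
  proof -
    have pk: "p i < k" if "i < k" for i using p that permutes_in_image[OF p, of i] by auto
    have "(\<Prod>i = 0..<k. B $$ (i, p i)) = (\<Prod>i = 0..<k. d i * A $$ (i, p i) / d (p i))"
      by (rule prod.cong) (use AB pk in auto)
    also have "\<dots> = (\<Prod>i = 0..<k. d i) * (\<Prod>i = 0..<k. A $$ (i, p i)) / (\<Prod>i = 0..<k. d (p i))"
      by (simp add: prod_dividef prod.distrib)
    also have "(\<Prod>i = 0..<k. d (p i)) = (\<Prod>i = 0..<k. d i)"
      using prod.permute[OF p, of d] by (simp add: comp_def)
    finally show ?thesis using d by simp
  qed
  then show ?thesis unfolding det_def'[OF A] det_def'[OF B] by (intro sum.cong) auto
qed

lemma submatrix_carrier:
  assumes "A \<in> carrier_mat n n" "S \<subseteq> {..<n}"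
  shows "submatrix A S S \<in> carrier_mat (card S) (card S)"
proof -
  have "{i. i < n \<and> i \<in> S} = S" using assms by auto
  then show ?thesis using assms by (auto simp: dim_submatrix)
qed

lemma submatrix_entry:
  assumes A: "A \<in> carrier_mat n n" and S: "S \<subseteq> {..<n}" and "T \<subseteq> {..<n}" "u < card S" "v < card T"
  shows "submatrix A S T $$ (u, v) = A $$ (pick S u, pick T v)" "pick S u \<in> S" "pick T v \<in> T"
proof -
  have e: "{i. i < n \<and> i \<in> S} = S" "{i. i < n \<and> i \<in> T} = T" using assms by auto
  show "submatrix A S T $$ (u, v) = A $$ (pick S u, pick T v)"
    using assms by (intro submatrix_index) (auto simp: e)
  show "pick S u \<in> S" "pick T v \<in> T" using assms by (auto intro: pick_in_set_le)
qed

lemma det_submatrix_diag_similar: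
  fixes A B :: "'a::field mat"
  assumes A: "A \<in> carrier_mat n n" and B: "B \<in> carrier_mat n n" and S: "S \<subseteq> {..<n}"
    and d: "\<And>i. i < n \<Longrightarrow> d i \<noteq> 0"
    and AB: "\<And>i j. \<lbrakk>i < n; j < n\<rbrakk> \<Longrightarrow> B $$ (i, j) = d i * A $$ (i, j) / d j"
  shows "det (submatrix B S S) = det (submatrix A S S)"
proof (rule det_diag_similar[OF submatrix_carrier[OF A S] submatrix_carrier[OF B S], of "\<lambda>u. d (pick S u)"])
  fix u v assume uv: "u < card S" "v < card S"
  show "submatrix B S S $$ (u, v) = d (pick S u) * submatrix A S S $$ (u, v) / d (pick S v)"
    using submatrix_entry[OF A S S uv] submatrix_entry[OF B S S uv] AB S by auto
next
  fix u assume "u < card S"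
  then have "pick S u \<in> S" by (rule pick_in_set_le)
  then show "d (pick S u) \<noteq> 0" using d S by auto
qed

section \<open>Rank at most one and 2 by 2 minors\<close>

lemma mat_rank_le_1I:
  fixes A :: "'a::field mat"
  assumes A: "A \<in> carrier_mat n n" and S: "S \<subseteq> {..<n}" and T: "T \<subseteq> {..<n}"
    and x: "x0 \<in> S" "y0 \<in> T" "A $$ (x0, y0) \<noteq> 0"
    and p: "\<And>x y. \<lbrakk>x \<in> S; y \<in> T\<rbrakk> \<Longrightarrow> A $$ (x, y) * A $$ (x0, y0) = A $$ (x, y0) * A $$ (x0, y)"
  shows "mat_rank (submatrix A S T) \<le> 1"
proof -
  let ?M = "submatrix A S T"
  have e: "{i. i < n \<and> i \<in> S} = S" "{i. i < n \<and> i \<in> T} = T" using S T by auto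
  have dim: "dim_row ?M = card S" "dim_col ?M = card T" using A by (auto simp: dim_submatrix e)
  have "vec_space.rank (dim_row ?M) ?M \<le> 1"
  proof (rule vec_space.rank_le_1_product_entries[of _ _ "dim_col ?M"
        "\<lambda>u. A $$ (pick S u, y0)" "\<lambda>v. A $$ (x0, pick T v) / A $$ (x0, y0)"])
    fix u v assume uv: "u < dim_row ?M" "v < dim_col ?M"
    have "pick S u \<in> S" "pick T v \<in> T" "?M $$ (u, v) = A $$ (pick S u, pick T v)"
      using submatrix_entry[OF A S T, of u v] uv dim by auto
    then show "?M $$ (u, v) = A $$ (pick S u, y0) * (A $$ (x0, pick T v) / A $$ (x0, y0))"
      using p[of "pick S u" "pick T v"] x by (simp add: field_simps)
  qed auto
  then show ?thesis by (simp add: mat_rank_def)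
qed

lemma card_less_mono:
  assumes "finite S" "x \<in> S" "x < (x'::nat)"
  shows "card {a \<in> S. a < x} < card {a \<in> S. a < x'}"
  using assms by (intro psubset_card_mono) auto

text \<open>A nonzero 2 by 2 minor forces rank at least two. Since \<open>submatrix\<close> lists
  indices increasingly, ordered pairs come first; \<open>c\<close> gives the position of an index
  inside the submatrix.\<close>

lemma mat_rank_le_1D:
  fixes A :: "'a::field mat"
  assumes A: "A \<in> carrier_mat n n" and S: "S \<subseteq> {..<n}" and T: "T \<subseteq> {..<n}"
    and r: "mat_rank (submatrix A S T) \<le> 1"
    and x: "x \<in> S" "x' \<in> S" "y \<in> T" "y' \<in> T"
  shows "A $$ (x, y) * A $$ (x', y') = A $$ (x, y') * A $$ (x', y)"
proof -
  let ?M = "submatrix A S T"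
  have e: "{i. i < n \<and> i \<in> S} = S" "{i. i < n \<and> i \<in> T} = T" using S T by auto
  have dim: "dim_row ?M = card S" "dim_col ?M = card T" using A by (auto simp: dim_submatrix e)
  have fin: "finite S" "finite T" using S T finite_subset by auto
  have lt: "A $$ (x, y) * A $$ (x', y') = A $$ (x, y') * A $$ (x', y)"
    if x: "x \<in> S" "x' \<in> S" "y \<in> T" "y' \<in> T" and l: "x < x'" "y < y'" for x x' y y'
  proof (rule ccontr)
    assume ne: "\<not> ?thesis"
    define c where "c P z = card {a \<in> P. a < z}" for P and z :: nat
    have cS: "c S z < card S" if "z \<in> S" for z
      unfolding c_def using that fin by (intro psubset_card_mono) auto
    have cT: "c T z < card T" if "z \<in> T" for z
      unfolding c_def using that fin by (intro psubset_card_mono) auto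
    have ent: "?M $$ (c S z, c T w) = A $$ (z, w)" if "z \<in> S" "w \<in> T" for z w
      unfolding c_def using that A S T by (intro submatrix_index_card) auto
    have srt: "sorted_wrt (<) [c S x, c S x']" "sorted_wrt (<) [c T y, c T y']"
      using card_less_mono[OF fin(1) x(1) l(1)] card_less_mono[OF fin(2) x(3) l(2)] by (auto simp: c_def)
    have "submatrix ?M (set [c S x, c S x']) (set [c T y, c T y']) =
        mat 2 2 (\<lambda>(u, v). ?M $$ ([c S x, c S x'] ! u, [c T y, c T y'] ! v))"
      using submatrix_sorted[OF srt(1) _ srt(2), of ?M] cS cT x dim by (simp add: numeral_2_eq_2)
    then have "det (submatrix ?M (set [c S x, c S x']) (set [c T y, c T y'])) \<noteq> 0"
      using ne ent x by (simp add: det_mat_2)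
    then have "card {j. j < dim_col ?M \<and> j \<in> set [c T y, c T y']} \<le> vec_space.rank (dim_row ?M) ?M"
      by (intro vec_space.rank_gt_minor) auto
    moreover have "{j. j < dim_col ?M \<and> j \<in> set [c T y, c T y']} = {c T y, c T y'}"
      using cT x dim by auto
    ultimately have "2 \<le> mat_rank ?M" using srt by (simp add: mat_rank_def)
    then show False using r by simp
  qed
  consider "x = x' \<or> y = y'" | "x < x'" "y < y'" | "x < x'" "y' < y" | "x' < x" "y < y'" | "x' < x" "y' < y"
    by linarith
  then show ?thesis
  proof cases
    case 1 then show ?thesis by (auto simp: mult.commute)
  next
    case 2 then show ?thesis using lt[of x x' y y'] x by simp
  next
    case 3 then show ?thesis using lt[of x x' y' y] x by simp
  next
    case 4 then show ?thesis using lt[of x' x y y'] x by (simp add: mult.commute)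
  next
    case 5 then show ?thesis using lt[of x' x y' y] x by (simp add: mult.commute)
  qed
qed

lemma mat_rank_nonzero:
  fixes A :: "'a::field mat"
  assumes A: "A \<in> carrier_mat n n" and S: "S \<subseteq> {..<n}" and T: "T \<subseteq> {..<n}"
    and x: "x \<in> S" "y \<in> T" "A $$ (x, y) \<noteq> 0"
  shows "1 \<le> mat_rank (submatrix A S T)"
proof -
  let ?M = "submatrix A S T"
  have e: "{i. i < n \<and> i \<in> S} = S" "{i. i < n \<and> i \<in> T} = T" using S T by auto
  have dim: "dim_row ?M = card S" "dim_col ?M = card T" using A by (auto simp: dim_submatrix e)
  have fin: "finite S" "finite T" using S T finite_subset by auto
  define u where "u = card {a \<in> S. a < x}"
  define v where "v = card {a \<in> T. a < y}"
  have uv: "u < card S" "v < card T"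
    unfolding u_def v_def using x fin by (auto intro!: psubset_card_mono)
  have "?M $$ (u, v) = A $$ (x, y)"
    unfolding u_def v_def using x A S T by (intro submatrix_index_card) auto
  moreover have "submatrix ?M (set [u]) (set [v]) = mat 1 1 (\<lambda>(r, s). ?M $$ ([u] ! r, [v] ! s))"
    using submatrix_sorted[of "[u]" ?M "[v]"] uv dim by simp
  ultimately have "det (submatrix ?M (set [u]) (set [v])) \<noteq> 0" using x by (simp add: det_single)
  then have "card {j. j < dim_col ?M \<and> j \<in> set [v]} \<le> vec_space.rank (dim_row ?M) ?M"
    by (intro vec_space.rank_gt_minor) auto
  moreover have "{j. j < dim_col ?M \<and> j \<in> set [v]} = {v}" using uv dim by auto
  ultimately show ?thesis by (simp add: mat_rank_def)
qed

section \<open>From property R and equal small minors to \<open>minors4\<close>\<close>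

lemma quad_commute:
  "quad f i j k l = quad f j i k l" "quad f i j k l = quad f i k j l" "quad f i j k l = quad f i j l k"
  by (simp_all add: quad_def mult_ac add_ac)

text \<open>Minors are read off on increasing lists only; symmetry of the 3-cycle sums and of
  \<open>quad\<close> carries the relations to arbitrary order.\<close>

lemma minors4_of_property_R:
  fixes A B :: "'a::field mat" and n :: nat
  assumes A: "A \<in> carrier_mat n n" and B: "B \<in> carrier_mat n n" and R: "property_R n A"
    and H: "\<And>S. \<lbrakk>S \<subseteq> {..<n}; S \<noteq> {}; card S \<le> 4\<rbrakk> \<Longrightarrow> det (submatrix A S S) = det (submatrix B S S)"
  shows "minors4 (\<lambda>i j. A $$ (i, j)) {..<n} (\<lambda>i j. B $$ (i, j))" (is "minors4 ?a _ ?b")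
    and "\<And>i. i < n \<Longrightarrow> B $$ (i, i) = A $$ (i, i)"
proof -
  have nz: "A $$ (x, y) \<noteq> 0" if "x < n" "y < n" "x \<noteq> y" for x y
    using R that by (auto simp: property_R_def)
  have minor: "det (mat (length xs) (length xs) (\<lambda>(u, v). ?a (xs ! u) (xs ! v))) =
      det (mat (length xs) (length xs) (\<lambda>(u, v). ?b (xs ! u) (xs ! v)))"
    if xs: "sorted_wrt (<) xs" "set xs \<subseteq> {..<n}" "xs \<noteq> []" "length xs \<le> 4" for xs
  proof -
    have "card (set xs) \<le> 4" using xs card_length[of xs] by linarith
    then have "det (submatrix A (set xs) (set xs)) = det (submatrix B (set xs) (set xs))" using H xs by auto
    moreover have "set xs \<subseteq> {..<dim_row A}" "set xs \<subseteq> {..<dim_col A}" "set xs \<subseteq> {..<dim_row B}"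
      "set xs \<subseteq> {..<dim_col B}" using xs(2) A B by auto
    ultimately show ?thesis
      using submatrix_sorted[OF xs(1) _ xs(1), of A] submatrix_sorted[OF xs(1) _ xs(1), of B] by simp
  qed
  show one: "?b i i = ?a i i" if "i < n" for i
    using minor[of "[i]"] that by (simp add: det_single)
  have two': "?b i j * ?b j i = ?a i j * ?a j i" if "i < j" "j < n" for i j
    using minor[of "[i, j]"] that one[of i] one[of j]
    by (simp add: det_mat_2[unfolded numeral_2_eq_2])
  have two: "?b i j * ?b j i = ?a i j * ?a j i" if "i < n" "j < n" "i \<noteq> j" for i j
    using two'[of i j] two'[of j i] that by (cases "i < j") (auto simp: mult.commute)
  have three': "cyc ?b i j k + cyc ?b i k j = cyc ?a i j k + cyc ?a i k j" if "i < j" "j < k" "k < n" for i j k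
  proof -
    have "det (mat 3 3 (\<lambda>(u, v). ?a ([i, j, k] ! u) ([i, j, k] ! v))) =
        det (mat 3 3 (\<lambda>(u, v). ?b ([i, j, k] ! u) ([i, j, k] ! v)))"
      using minor[of "[i, j, k]"] that by (simp add: numeral_eq_Suc)
    then show ?thesis
      unfolding det_mat_3[OF refl, of ?a] det_mat_3[OF refl, of ?b]
      using one[of i] one[of j] one[of k] two[of i j] two[of j k] two[of i k] that by simp
  qed
  have three: "cyc ?b i j k + cyc ?b i k j = cyc ?a i j k + cyc ?a i k j"
    if d: "distinct [i, j, k]" "{i, j, k} \<subseteq> {..<n}" for i j k
  proof -
    have rot: "cyc f j k i + cyc f j i k = cyc f i j k + cyc f i k j"
      "cyc f k i j + cyc f k j i = cyc f i j k + cyc f i k j" "cyc f i k j + cyc f i j k = cyc f i j k + cyc f i k j"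
      "cyc f j i k + cyc f j k i = cyc f i j k + cyc f i k j" "cyc f k j i + cyc f k i j = cyc f i j k + cyc f i k j"
      for f :: "nat \<Rightarrow> nat \<Rightarrow> 'a"
      by (simp_all add: cyc_def mult_ac add_ac)
    consider "i < j" "j < k" | "i < k" "k < j" | "j < i" "i < k" | "j < k" "k < i" | "k < i" "i < j" | "k < j" "j < i"
      using d by (auto simp: neq_iff)
    then show ?thesis
      using three'[of i j k] three'[of i k j] three'[of j i k] three'[of j k i] three'[of k i j] three'[of k j i] d
      unfolding rot by cases auto
  qed
  have four1: "quad ?b i j k l = quad ?a i j k l" if s: "i < j" "j < k" "k < l" "l < n" for i j k l
  proof -
    have "det (mat 4 4 (\<lambda>(u, v). ?a ([i, j, k, l] ! u) ([i, j, k, l] ! v))) =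
        det (mat 4 4 (\<lambda>(u, v). ?b ([i, j, k, l] ! u) ([i, j, k, l] ! v)))"
      using minor[of "[i, j, k, l]"] s by (simp add: numeral_eq_Suc)
    then show ?thesis
      unfolding det_mat_4[OF refl, of ?a] det_mat_4[OF refl, of ?b]
      using one[of i] one[of j] one[of k] one[of l] two[of i j] two[of j k] two[of i k] two[of i l] two[of j l]
        two[of k l] three[of i j k] three[of i j l] three[of i k l] three[of j k l] s by simp
  qed
  have four2: "quad ?b i j k l = quad ?a i j k l"
    if s: "i < j" "k < l" "distinct [i, j, k, l]" "{i, j, k, l} \<subseteq> {..<n}" for i j k l
  proof -
    have p: "quad f i k j l = quad f i j k l" "quad f i k l j = quad f i j k l" "quad f k i j l = quad f i j k l"
      "quad f k i l j = quad f i j k l" "quad f k l i j = quad f i j k l" for f :: "nat \<Rightarrow> nat \<Rightarrow> 'a"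
      by (simp_all add: quad_commute)
    consider "j < k" | "i < k" "k < j" "j < l" | "i < k" "l < j" | "k < i" "j < l" | "k < i" "i < l" "l < j" | "l < i"
      using s by (auto simp: neq_iff)
    then show ?thesis
      using four1[of i j k l] four1[of i k j l] four1[of i k l j] four1[of k i j l] four1[of k i l j] four1[of k l i j] s
      unfolding p by cases auto
  qed
  have four: "quad ?b i j k l = quad ?a i j k l" if d: "distinct [i, j, k, l]" "{i, j, k, l} \<subseteq> {..<n}" for i j k l
  proof -
    have p: "quad f j i k l = quad f i j k l" "quad f i j l k = quad f i j k l" "quad f j i l k = quad f i j k l"
      for f :: "nat \<Rightarrow> nat \<Rightarrow> 'a"
      by (simp_all add: quad_commute)
    consider "i < j" "k < l" | "j < i" "k < l" | "i < j" "l < k" | "j < i" "l < k"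
      using d by (auto simp: neq_iff)
    then show ?thesis
      using four2[of i j k l] four2[of j i k l] four2[of i j l k] four2[of j i l k] d
      unfolding p by cases auto
  qed
  show "minors4 ?a {..<n} ?b"
  proof
    fix i j k l m assume d: "distinct [i, j, k, l, m]" "{i, j, k, l, m} \<subseteq> {..<n}" and p: "par ?a i j k l"
    have ij: "{i, j} \<subseteq> {..<n}" and kl: "{k, l} \<subseteq> {..<n}" using d by auto
    have ik: "A $$ (i, k) \<noteq> 0" using nz d by auto
    have "mat_rank (submatrix A {i, j} {k, l}) \<le> 1"
      by (rule mat_rank_le_1I[OF A ij kl, of i k])
        (use ik p in \<open>auto simp: par_def mult.commute\<close>)
    \<comment> \<open>Property R asks for rank exactly one; the nonzero off-diagonal entry excludes
      rank zero.\<close>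
    moreover have "1 \<le> mat_rank (submatrix A {i, j} {k, l})"
      by (rule mat_rank_nonzero[OF A ij kl _ _ ik]) auto
    ultimately have "mat_rank (submatrix A {i, j} {k, l}) = 1" by simp
    then obtain S where S: "S \<subseteq> {..<n}" "i \<in> S" "j \<in> S" "k \<in> {..<n} - S" "l \<in> {..<n} - S"
      "mat_rank (submatrix A S ({..<n} - S)) = 1"
      using R[unfolded property_R_def, THEN conjunct2, rule_format, of i j k l] d by auto
    have D: "par ?a x x' y y'" if "x \<in> S" "x' \<in> S" "y \<in> {..<n} - S" "y' \<in> {..<n} - S" for x x' y y'
      unfolding par_def by (rule mat_rank_le_1D[OF A S(1) _ _ that]) (use S(6) in auto)
    show "par ?a i m k l \<or> par ?a i j k m"
    proof (cases "m \<in> S")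
      case True then show ?thesis using D[of i m k l] S by auto
    next
      case False then show ?thesis using D[of i j k m] S d by auto
    qed
  qed (use nz two three four in auto)
qed

lemma is_cut_of_cutset:
  fixes A :: "'a::field mat" and n :: nat
  assumes A: "A \<in> carrier_mat n n" and nz: "\<And>x y. \<lbrakk>x < n; y < n; x \<noteq> y\<rbrakk> \<Longrightarrow> A $$ (x, y) \<noteq> 0"
    and c: "cutset (\<lambda>i j. A $$ (i, j)) {..<n} X"
  shows "is_cut n A X"
proof -
  let ?Y = "{..<n} - X"
  obtain x x' y y' where e: "x \<in> X" "x' \<in> X" "x \<noteq> x'" "y \<in> ?Y" "y' \<in> ?Y" "y \<noteq> y'" "X \<subseteq> {..<n}"
    using c unfolding cutset_def by blast
  have cc: "cut4 (\<lambda>i j. A $$ (i, j)) z z' w w'" if "z \<in> X" "z' \<in> X" "w \<in> ?Y" "w' \<in> ?Y" for z z' w w'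
    using c that unfolding cutset_def by blast
  have fin: "finite X" using e finite_subset by auto
  have c1: "2 \<le> card X" using card_mono[of X "{x, x'}"] e fin by auto
  have c2: "2 \<le> card ?Y" using card_mono[of ?Y "{y, y'}"] e by auto
  have c3: "card ?Y = n - card X" using card_Diff_subset[OF fin e(7)] by simp
  have xy: "A $$ (x, y) \<noteq> 0" "A $$ (y, x) \<noteq> 0" using nz[of x y] nz[of y x] e by auto
  have "mat_rank (submatrix A X ?Y) \<le> 1"
    by (rule mat_rank_le_1I[OF A e(7) _ e(1,4) xy(1)])
      (use cc e in \<open>auto simp: cut4_def par_def\<close>)
  moreover have "mat_rank (submatrix A ?Y X) \<le> 1"
    by (rule mat_rank_le_1I[OF A _ e(7) e(4,1) xy(2)])
      (use cc e in \<open>auto simp: cut4_def par_def\<close>)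
  ultimately show ?thesis unfolding is_cut_def using c1 c2 c3 e by auto
qed

section \<open>Diagonal similarity from equal 3-cycles, and the conclusion\<close>

context minors4
begin

text \<open>Normalizing \<open>d z = 1\<close>, row \<open>z\<close> dictates all other values of
  \<open>d\<close>; the 3-cycle through \<open>z\<close>, \<open>i\<close>, \<open>j\<close> then
  settles the entry at \<open>(i, j)\<close>.\<close>

lemma diag_similar_of_all_same:
  assumes s: "all_same V" and one: "\<And>i. i \<in> V \<Longrightarrow> b i i = a i i"
  shows "\<exists>d. (\<forall>i\<in>V. d i \<noteq> 0) \<and> (\<forall>i\<in>V. \<forall>j\<in>V. b i j = d i * a i j / d j)"
proof (cases "V = {}")
  case False
  then obtain z where z: "z \<in> V" by blast
  have bnz: "b i j \<noteq> 0" if "i \<in> V" "j \<in> V" "i \<noteq> j" for i j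
    using two[of i j] nz[of i j] nz[of j i] that by auto
  \<comment> \<open>The root is treated separately because \<open>a z z\<close> and
    \<open>b z z\<close> may vanish.\<close>
  define d where "d i = (if i = z then 1 else a z i / b z i)" for i
  have dnz: "d i \<noteq> 0" if "i \<in> V" for i
    using that z nz[of z i] bnz[of z i] by (auto simp: d_def)
  have "b i j = d i * a i j / d j" if ij: "i \<in> V" "j \<in> V" for i j
  proof -
    consider "i = j" | "i = z" "j \<noteq> z" | "j = z" "i \<noteq> z" | "distinct [z, i, j]" by auto
    then show ?thesis
    proof cases
      case 1 then show ?thesis using one dnz ij by simp
    next
      case 2 then show ?thesis using nz[of z j] bnz[of z j] ij z by (simp add: d_def)
    next
      case 3 then show ?thesis using two[of z i] bnz[of z i] ij z by (simp add: d_def field_simps)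
    next
      case 4
      have n: "a z i \<noteq> 0" "a z j \<noteq> 0" "a j z \<noteq> 0" "b z i \<noteq> 0" "b z j \<noteq> 0" "b j z \<noteq> 0"
        using 4 z ij nz bnz by auto
      have c: "b z i * b i j * b j z = a z i * a i j * a j z"
        using all_sameD[OF s z ij] 4 by (simp add: same_def cyc_def)
      have t: "b z j * b j z = a z j * a j z" using two[of z j] 4 z ij by auto
      have "b i j * (b z i * a z j) * a j z = b i j * b z i * (b z j * b j z)"
        unfolding t by (simp add: mult_ac)
      also have "\<dots> = (b z i * b i j * b j z) * b z j" by (simp add: mult_ac)
      also have "\<dots> = (a z i * a i j * b z j) * a j z" unfolding c by (simp add: mult_ac)
      finally have "b i j * (b z i * a z j) = a z i * a i j * b z j" using n by simp
      moreover have di: "d i = a z i / b z i" "d j = a z j / b z j" using 4 by (auto simp: d_def)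
      ultimately show ?thesis unfolding di using n by (simp add: field_simps)
    qed
  qed
  then show ?thesis using dnz by blast
qed simp

end

theorem theorem5p9:
  fixes A B :: "'a::field mat" and n :: nat
  assumes "A \<in> carrier_mat n n" and "B \<in> carrier_mat n n"
    and "property_R n A"
    and "\<not> (\<exists>X. is_cut n A X)"
  shows "(\<forall>S. S \<subseteq> {..<n} \<and> S \<noteq> {} \<longrightarrow>
            det (submatrix A S S) = det (submatrix B S S)) \<longleftrightarrow>
         (\<forall>S. S \<subseteq> {..<n} \<and> S \<noteq> {} \<and> card S \<le> 4 \<longrightarrow>
            det (submatrix A S S) = det (submatrix B S S))"
proof (intro iffI allI impI)
  fix S assume H: "\<forall>S. S \<subseteq> {..<n} \<and> S \<noteq> {} \<and> card S \<le> 4 \<longrightarrow> det (submatrix A S S) = det (submatrix B S S)"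
    and "S \<subseteq> {..<n} \<and> S \<noteq> {}"
  then have S: "S \<subseteq> {..<n}" by simp
  note A = assms(1) and B = assms(2)
  let ?a = "\<lambda>i j. A $$ (i, j)" and ?b = "\<lambda>i j. B $$ (i, j)"
  have M: "minors4 ?a {..<n} ?b" and one: "\<And>i. i < n \<Longrightarrow> B $$ (i, i) = A $$ (i, i)"
    using minors4_of_property_R[OF A B assms(3)] H by blast+
  interpret minors4 ?a "{..<n}" ?b by (rule M)
  have "\<not> (\<exists>X. cutset ?a {..<n} X)" using is_cut_of_cutset[OF A] nz assms(4) by blast
  from all_same_or_all_turned[OF this] show "det (submatrix A S S) = det (submatrix B S S)"
  proof
    assume "all_same {..<n}"
    then obtain d where "\<forall>i\<in>{..<n}. d i \<noteq> 0" "\<forall>i\<in>{..<n}. \<forall>j\<in>{..<n}. ?b i j = d i * ?a i j / d j"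
      using diag_similar_of_all_same one by blast
    then show ?thesis using det_submatrix_diag_similar[OF A B S, of d] by simp
  next
    assume t: "all_turned {..<n}"
    interpret F: minors4 ?a "{..<n}" "flip_args ?b" by (rule flip_b)
    have "F.all_same {..<n}" using t by (simp add: F.all_same_def all_turned_def turned_flip)
    then obtain d where d: "\<forall>i\<in>{..<n}. d i \<noteq> 0"
      "\<forall>i\<in>{..<n}. \<forall>j\<in>{..<n}. flip_args ?b i j = d i * ?a i j / d j"
      using F.diag_similar_of_all_same one by (auto simp: flip_args_def)
    \<comment> \<open>In the turned case it is the transpose of \<open>B\<close> that is diagonally
      similar to \<open>A\<close>, and transposition preserves principal minors.\<close>
    have Bt: "transpose_mat B \<in> carrier_mat n n" using B by simp
    have "det (submatrix (transpose_mat B) S S) = det (submatrix A S S)"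
      by (rule det_submatrix_diag_similar[OF A Bt S, of d]) (use d B in \<open>auto simp: flip_args_def\<close>)
    moreover have "submatrix (transpose_mat B) S S = transpose_mat (submatrix B S S)"
    proof (rule eq_matI)
      fix u v assume "u < dim_row (transpose_mat (submatrix B S S))" "v < dim_col (transpose_mat (submatrix B S S))"
      then have uv: "u < card S" "v < card S" using submatrix_carrier[OF B S] by auto
      show "submatrix (transpose_mat B) S S $$ (u, v) = transpose_mat (submatrix B S S) $$ (u, v)"
      proof -
        have "pick S u < n" "pick S v < n" using submatrix_entry[OF B S S uv] S by auto
        then show ?thesis
          using submatrix_entry(1)[OF Bt S S uv] submatrix_entry(1)[OF B S S uv(2,1)] submatrix_carrier[OF B S] uv B
          by auto
      qed
    qed (use submatrix_carrier[OF Bt S] submatrix_carrier[OF B S] in auto)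
    ultimately show ?thesis using det_transpose[OF submatrix_carrier[OF B S]] by simp
  qed
qed simp

end
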